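(* Let $X$ be any compact metric space (not necessarily ultrametric) and let $p\in[1,+\infty)$. If the Hausdorff dimension and the upper Minkowski dimension of $X$ are both equal to $d$, then $$\operatorname{crit}_{\mathscr{P}}\mathscr{W}_p(X)=d.$$
   Context: For a compact metric space $X$ and $p\in[1,+\infty)$, $\mathscr{W}_p(X)=(\mathcal{P}(X),\mathrm{W}_p)$ is the set of Borel probability measures on $X$ endowed with the distance $$\mathrm{W}_p(\mu,\nu)=\left(\inf_{\Pi\in\Gamma(\mu,\nu)}\int_{X\times X}d(a,b)^p\,\Pi(\mathrm{d}a\,\mathrm{d}b)\right)^{1/p},$$ where $\Gamma(\mu,\nu)$ is the set of Borel probability measures on $X\times X$ with marginals $\mu$ and $\nu$. The upper Minkowski dimension of $X$ is $\limsup_{\varepsilon\to0}\frac{\log N(\varepsilon)}{\log(1/\varepsilon)}$, where $N(\varepsilon)$ is the least number of balls of radius $\varepsilon$ needed to cover $X$. The power-exponential critical parameter $\operatorname{crit}_{\mathscr{P}}Z\in[0,+\infty]$ of a metric space $Z$ is defined as the Hausdorff dimension, with $\varepsilon^s$ replaced by $\exp(-\varepsilon^{-s})$: for $s>0$ put $f_s(r)=\exp(-1/r^s)$ for $r>0$ and $f_s(0)=0$, and $$\mathcal{H}^{s}(Z)=\lim_{\delta\to0}\ \inf\Big\{\sum_i f_s(\operatorname{diam}E_i)\ :\ (E_i)\text{ a countable cover of }Z\text{ with }\operatorname{diam}E_i\le\delta\ \forall i\Big\}.$$ Then $\operatorname{crit}_{\mathscr{P}}Z=\sup\{s>0:\mathcal{H}^s(Z)>0\}$,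 with $\sup\emptyset=0$. *)

theory Defs
  imports "HOL-Probability.Probability"
begin

section \<open>Caratheodory construction and critical parameter\<close>

text \<open>
  A metric space is given by a carrier \<open>Z\<close> and a distance function \<open>d\<close>, since the
  Wasserstein space is not a type. The sets of a cover are subsets of \<open>Z\<close>, so that \<open>d\<close> is only
  ever evaluated on \<open>Z\<close>; finite covers are padded with empty sets, which have diameter \<open>0\<close>.
\<close>

definition diam_on :: "('z \<Rightarrow> 'z \<Rightarrow> real) \<Rightarrow> 'z set \<Rightarrow> ennreal" where
  "diam_on d E = (SUP (x, y) \<in> E \<times> E. ennreal (d x y))"

definition fine_covers :: "'z set \<Rightarrow> ('z \<Rightarrow> 'z \<Rightarrow> real) \<Rightarrow> real \<Rightarrow> (nat \<Rightarrow> 'z set) set" where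
  "fine_covers Z d \<delta> = {E. (\<Union>i. E i) = Z \<and> (\<forall>i. diam_on d (E i) \<le> ennreal \<delta>)}"

definition cover_content ::
  "(real \<Rightarrow> real) \<Rightarrow> 'z set \<Rightarrow> ('z \<Rightarrow> 'z \<Rightarrow> real) \<Rightarrow> real \<Rightarrow> ennreal" where
  "cover_content f Z d \<delta> =
     (INF E \<in> fine_covers Z d \<delta>. \<Sum>i. ennreal (f (enn2real (diam_on d (E i)))))"

definition gauge_measure :: "(real \<Rightarrow> real) \<Rightarrow> 'z set \<Rightarrow> ('z \<Rightarrow> 'z \<Rightarrow> real) \<Rightarrow> ennreal" where
  "gauge_measure f Z d = Lim (at_right 0) (cover_content f Z d)"

text \<open>\<open>Lim\<close> is only meaningful when the limit exists; by monotonicity it always does here.\<close>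

lemma cover_content_antimono:
  assumes "\<delta> \<le> \<delta>'"
  shows "cover_content f Z d \<delta>' \<le> cover_content f Z d \<delta>"
  unfolding cover_content_def
  by (rule INF_superset_mono) (use assms in \<open>auto simp: fine_covers_def intro: order_trans ennreal_leI\<close>)

lemma tendsto_cover_content:
  "(cover_content f Z d \<longlongrightarrow> (SUP \<delta> \<in> {0<..}. cover_content f Z d \<delta>)) (at_right 0)"
proof (rule increasing_tendsto)
  show "\<forall>\<^sub>F \<delta> in at_right 0. cover_content f Z d \<delta> \<le> (SUP \<delta> \<in> {0<..}. cover_content f Z d \<delta>)"
    using eventually_at_right_less[of "0::real"]
    by (rule eventually_mono) (auto intro: SUP_upper)
next
  fix x assume "x < (SUP \<delta> \<in> {0<..}. cover_content f Z d \<delta>)"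
  then obtain \<delta>0 :: real where "0 < \<delta>0" "x < cover_content f Z d \<delta>0"
    by (auto simp: less_SUP_iff)
  then show "\<forall>\<^sub>F \<delta> in at_right 0. x < cover_content f Z d \<delta>"
    by (auto simp: eventually_at_right intro!: exI[of _ \<delta>0]
        intro: less_le_trans cover_content_antimono less_imp_le)
qed

lemma gauge_measure_eq_SUP:
  "gauge_measure f Z d = (SUP \<delta> \<in> {0<..}. cover_content f Z d \<delta>)"
  unfolding gauge_measure_def by (rule tendsto_Lim[OF _ tendsto_cover_content]) simp

text \<open>In \<^typ>\<open>ennreal\<close> the supremum of the empty set is \<open>0\<close>.\<close>

definition critical_parameter ::
  "(real \<Rightarrow> real \<Rightarrow> real) \<Rightarrow> 'z set \<Rightarrow> ('z \<Rightarrow> 'z \<Rightarrow> real) \<Rightarrow> ennreal" where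
  "critical_parameter f Z d = (SUP s \<in> {s. 0 < s \<and> 0 < gauge_measure (f s) Z d}. ennreal s)"

definition hausdorff_dim :: "'z set \<Rightarrow> ('z \<Rightarrow> 'z \<Rightarrow> real) \<Rightarrow> ennreal" where
  "hausdorff_dim = critical_parameter (\<lambda>s r. r powr s)"

definition pexp_gauge :: "real \<Rightarrow> real \<Rightarrow> real" where
  "pexp_gauge s r = (if 0 < r then exp (- (1 / r powr s)) else 0)"

definition crit_pexp :: "'z set \<Rightarrow> ('z \<Rightarrow> 'z \<Rightarrow> real) \<Rightarrow> ennreal" where
  "crit_pexp = critical_parameter pexp_gauge"


section \<open>Upper Minkowski dimension\<close>

definition covering_number :: "'a::metric_space set \<Rightarrow> real \<Rightarrow> nat" where
  "covering_number X \<epsilon> =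
     (LEAST n. \<exists>C. C \<subseteq> X \<and> finite C \<and> card C = n \<and> X \<subseteq> (\<Union>c\<in>C. ball c \<epsilon>))"

text \<open>
  For nonempty compact \<open>X\<close> the quotient is nonnegative as soon as \<open>\<epsilon> < 1\<close>, so passing to
  \<^typ>\<open>ennreal\<close> does not affect the upper limit.
\<close>

definition upper_minkowski_dim :: "'a::metric_space set \<Rightarrow> ennreal" where
  "upper_minkowski_dim X =
     Limsup (at_right 0) (\<lambda>\<epsilon>. ennreal (ln (real (covering_number X \<epsilon>)) / ln (1 / \<epsilon>)))"


section \<open>Wasserstein space\<close>

definition borel_probs :: "'a::topological_space measure set" where
  "borel_probs = {\<mu>. prob_space \<mu> \<and> sets \<mu> = sets borel}"

text \<open>
  Couplings live on the Borel sigma-algebra of the product space. On \<open>borel_probs\<close>, equality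
  of measures is equality of the values on all Borel sets.
\<close>

definition couplings ::
  "'a::metric_space measure \<Rightarrow> 'a measure \<Rightarrow> ('a \<times> 'a) measure set" where
  "couplings \<mu> \<nu> = {\<gamma> \<in> borel_probs. distr \<gamma> borel fst = \<mu> \<and> distr \<gamma> borel snd = \<nu>}"

text \<open>The transport cost is finite whenever the underlying space is bounded.\<close>

definition wasserstein_dist :: "real \<Rightarrow> 'a::metric_space measure \<Rightarrow> 'a measure \<Rightarrow> real" where
  "wasserstein_dist p \<mu> \<nu> =
     enn2real (INF \<gamma> \<in> couplings \<mu> \<nu>. \<integral>\<^sup>+ (a, b). ennreal (dist a b powr p) \<partial>\<gamma>) powr (1 / p)"

end

theory Submission
  imports Defs "HOL-Real_Asymp.Real_Asymp"
begin

text \<open>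
  Upper bound: partition \<open>X\<close> into \<open>N(\<epsilon>)\<close> pieces of diameter at most \<open>2\<epsilon>\<close>. Measures whose masses on
  the pieces agree up to a small power of \<open>\<epsilon>\<close> are at distance at most \<open>3\<epsilon>\<close>, so
  \<open>exp (O(N(\<epsilon>) log (1/\<epsilon>)))\<close> sets of that diameter cover the Wasserstein space.

  Lower bound: for \<open>t\<close> below the Hausdorff dimension there are, at every small scale \<open>r\<close>, more than
  \<open>r\<close> to the power \<open>-t\<close> points at mutual distance at least \<open>r\<close>. Each subset of such a set of \<open>n\<close> points
  encodes a measure, and subsets differing in a fixed proportion of the points give measures at \<open>W\<^sub>1\<close>
  distance of order \<open>r\<close>. A convex combination over the scales \<open>r\<^sub>k\<close> with independent uniform subsets is
  a random measure. Transport duality is insensitive to the scales shared by two measures, so a set of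
  small diameter only contains, given the coarser scales, the words of one Hamming ball, whose
  probability is at most \<open>(3/4)\<close> to the power \<open>n\<close>. Hence the random measure lies in a set of diameter
  \<open>\<rho>\<close> with probability at most \<open>exp (-1 / \<rho> powr t)\<close>, and the mass distribution principle applies.
\<close>

section \<open>Couplings with prescribed mass between cells\<close>

lemma finite_ball_cover:
  assumes "compact (UNIV :: 'a::metric_space set)" and "0 < e"
  shows "\<exists>C :: 'a set. finite C \<and> UNIV = (\<Union>c\<in>C. ball c e)"
proof -
  have "UNIV \<subseteq> (\<Union>c. ball c e :: 'a set)"
    using \<open>0 < e\<close> by (auto intro: centre_in_ball[THEN iffD2])
  then obtain C :: "'a set" where "finite C" "UNIV \<subseteq> (\<Union>c\<in>C. ball c e)"
    using compactE_image[OF assms(1), of UNIV "\<lambda>c. ball c e"] by (metis open_ball)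
  then show ?thesis by blast
qed

text \<open>The library version \<open>borel_prod\<close> needs the type class \<open>second_countable_topology\<close>.\<close>

lemma sets_borel_pair_compact:
  assumes "compact (UNIV :: 'a::metric_space set)"
  shows "sets (borel \<Otimes>\<^sub>M borel) = sets (borel :: ('a \<times> 'a) measure)"
proof
  have "(\<lambda>z. (fst z, snd z)) \<in> measurable (borel :: ('a \<times> 'a) measure) (borel \<Otimes>\<^sub>M borel)"
    by (intro measurable_Pair borel_measurable_continuous_onI continuous_intros)
  then have "A \<in> sets borel" if "A \<in> sets (borel \<Otimes>\<^sub>M borel)" for A :: "('a \<times> 'a) set"
    using measurable_sets[OF _ that, of "\<lambda>z. (fst z, snd z)" borel] by simp
  then show "sets (borel \<Otimes>\<^sub>M borel) \<subseteq> sets (borel :: ('a \<times> 'a) measure)"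
    by blast
next
  have "\<exists>C :: 'a set. finite C \<and> UNIV = (\<Union>c\<in>C. ball c (1 / Suc n))" for n
    using assms by (intro finite_ball_cover) auto
  then obtain C :: "nat \<Rightarrow> 'a set" where fin: "\<And>n. finite (C n)"
    and cover: "\<And>n. UNIV = (\<Union>c\<in>C n. ball c (1 / Suc n))"
    by metis
  have "U \<in> sets (borel \<Otimes>\<^sub>M borel)" if U: "open U" for U :: "('a \<times> 'a) set"
  proof -
    \<comment> \<open>Compactness gives a countable base: balls of radius \<open>1 / Suc n\<close>
      about the finite nets \<open>C n\<close>. \<open>J n\<close> collects the rectangles of level
      \<open>n\<close> inside \<open>U\<close>, so \<open>U\<close> becomes a countable union of
      finite unions of measurable rectangles.\<close>
    define R where "R n = (\<lambda>(c :: 'a, c' :: 'a). ball c (1 / Suc n) \<times> ball c' (1 / Suc n))" for n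
    define J where "J n = {z \<in> C n \<times> C n. (R n) z \<subseteq> U}" for n
    have "U = (\<Union>n. \<Union>z\<in>J n. R n z)"
    proof
      show "U \<subseteq> (\<Union>n. \<Union>z\<in>J n. R n z)"
      proof
        fix u assume "u \<in> U"
        obtain x y where u: "u = (x, y)" by force
        obtain A B where AB: "open A" "open B" "(x, y) \<in> A \<times> B" "A \<times> B \<subseteq> U"
          using open_prod_elim[OF U \<open>u \<in> U\<close>] unfolding u by blast
        obtain e1 where e1: "e1 > 0" "ball x e1 \<subseteq> A" using AB openE by blast
        obtain e2 where e2: "e2 > 0" "ball y e2 \<subseteq> B" using AB openE by blast
        \<comment> \<open>A net ball of radius \<open>1 / Suc n\<close> that contains
          \<open>x\<close> stays within \<open>2 / Suc n\<close> of \<open>x\<close>, whence half of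
          \<open>min e1 e2\<close>.\<close>
        obtain n where n: "1 / Suc n < min e1 e2 / 2"
          using nat_approx_posE[of "min e1 e2 / 2"] e1 e2 by auto
        obtain c where c: "c \<in> C n" "dist c x < 1 / Suc n" using cover[of n] by (auto simp: set_eq_iff)
        obtain c' where c': "c' \<in> C n" "dist c' y < 1 / Suc n" using cover[of n] by (auto simp: set_eq_iff)
        have 1: "ball c (1 / Suc n) \<subseteq> A"
        proof
          fix z assume "z \<in> ball c (1 / Suc n)"
          then have "dist x z < e1" using c n dist_triangle[of x z c] by (auto simp: dist_commute)
          then show "z \<in> A" using e1 by auto
        qed
        have 2: "ball c' (1 / Suc n) \<subseteq> B"
        proof
          fix z assume "z \<in> ball c' (1 / Suc n)"
          then have "dist y z < e2" using c' n dist_triangle[of y z c'] by (auto simp: dist_commute)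
          then show "z \<in> B" using e2 by auto
        qed
        have "R n (c, c') \<subseteq> U" using 1 2 AB(4) by (auto simp: R_def)
        then have "(c, c') \<in> J n" using c c' by (simp add: J_def)
        moreover have "u \<in> R n (c, c')" using c c' by (simp add: R_def u)
        ultimately show "u \<in> (\<Union>n. \<Union>z\<in>J n. R n z)" by blast
      qed
    qed (auto simp: J_def)
    also have "\<dots> \<in> sets (borel \<Otimes>\<^sub>M borel)"
    proof (intro sets.countable_UN sets.finite_UN image_subsetI)
      show "finite (J n)" for n using fin by (simp add: J_def)
      show "R n z \<in> sets (borel \<Otimes>\<^sub>M borel)" for n z
      by (cases z) (auto simp: R_def)
    qed
    finally show ?thesis .
  qed
  then have "sigma_sets (space (borel \<Otimes>\<^sub>M borel)) {U :: ('a \<times> 'a) set. open U} \<subseteq> sets (borel \<Otimes>\<^sub>M borel)"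
    by (intro sets.sigma_sets_subset) auto
  moreover have "sets (borel :: ('a \<times> 'a) measure) = sigma_sets UNIV {U. open U}"
    unfolding borel_def by (rule sets_measure_of) simp
  ultimately show "sets (borel :: ('a \<times> 'a) measure) \<subseteq> sets (borel \<Otimes>\<^sub>M borel)"
    by (simp add: space_pair_measure)
qed

section \<open>Integrals over the cells of a labelling\<close>

lemma nn_integral_label:
  fixes lab :: "'a \<Rightarrow> nat"
  assumes "prob_space \<nu>" and lab: "lab \<in> measurable \<nu> (count_space {..<n})"
    and nonneg: "\<And>j. j < n \<Longrightarrow> 0 \<le> \<phi> j"
  shows "(\<integral>\<^sup>+ y. ennreal (\<phi> (lab y)) \<partial>\<nu>) =
    ennreal (\<Sum>j<n. \<phi> j * measure \<nu> (lab -` {j} \<inter> space \<nu>))"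
proof -
  interpret prob_space \<nu> by fact
  have meas: "lab -` {j} \<inter> space \<nu> \<in> sets \<nu>" if "j < n" for j
    using lab that by (intro measurable_sets) auto
  have "(\<integral>\<^sup>+ y. ennreal (\<phi> (lab y)) \<partial>\<nu>)
      = (\<integral>\<^sup>+ y. (\<Sum>j<n. ennreal (\<phi> j) * indicator (lab -` {j} \<inter> space \<nu>) y) \<partial>\<nu>)"
  proof (rule nn_integral_cong)
    fix y assume y: "y \<in> space \<nu>"
    then have "lab y < n" using measurable_space[OF lab y] by simp
    have "(\<Sum>j<n. ennreal (\<phi> j) * indicator (lab -` {j} \<inter> space \<nu>) y)
        = (\<Sum>j<n. if j = lab y then ennreal (\<phi> j) else 0)"
      using y by (intro sum.cong) (auto simp: indicator_def)
    also have "\<dots> = ennreal (\<phi> (lab y))"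
      using \<open>lab y < n\<close> by simp
    finally show "ennreal (\<phi> (lab y)) = (\<Sum>j<n. ennreal (\<phi> j) * indicator (lab -` {j} \<inter> space \<nu>) y)"
      by simp
  qed
  also have "\<dots> = (\<Sum>j<n. ennreal (\<phi> j) * emeasure \<nu> (lab -` {j} \<inter> space \<nu>))"
    using meas by (subst nn_integral_sum) (auto simp: nn_integral_cmult_indicator)
  also have "\<dots> = (\<Sum>j<n. ennreal (\<phi> j * measure \<nu> (lab -` {j} \<inter> space \<nu>)))"
    using nonneg by (intro sum.cong) (auto simp: emeasure_eq_measure ennreal_mult)
  also have "\<dots> = ennreal (\<Sum>j<n. \<phi> j * measure \<nu> (lab -` {j} \<inter> space \<nu>))"
    using nonneg by (intro sum_ennreal) auto
  finally show ?thesis .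
qed

text \<open>Cells of mass zero are finitely many null sets. This permits dividing by the mass of the
  cell of almost every point.\<close>

lemma AE_label_pos:
  fixes lab :: "'a \<Rightarrow> nat"
  assumes "prob_space \<mu>" and lab: "lab \<in> measurable \<mu> (count_space {..<n})"
  shows "AE x in \<mu>. 0 < measure \<mu> (lab -` {lab x} \<inter> space \<mu>)"
proof -
  interpret prob_space \<mu> by fact
  have meas: "lab -` {j} \<inter> space \<mu> \<in> sets \<mu>" if "j < n" for j
    using lab that by (intro measurable_sets) auto
  have "AE x in \<mu>. \<forall>j\<in>{..<n}. lab x = j \<longrightarrow> 0 < measure \<mu> (lab -` {j} \<inter> space \<mu>)"
  proof (intro AE_finite_allI)
    fix j assume "j \<in> {..<n}"
    then have j: "lab -` {j} \<inter> space \<mu> \<in> sets \<mu>" using meas by simp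
    show "AE x in \<mu>. lab x = j \<longrightarrow> 0 < measure \<mu> (lab -` {j} \<inter> space \<mu>)"
    proof (cases "measure \<mu> (lab -` {j} \<inter> space \<mu>) = 0")
      case True
      then have "lab -` {j} \<inter> space \<mu> \<in> null_sets \<mu>"
        using j by (auto simp: null_sets_def emeasure_eq_measure)
      then show ?thesis by (rule AE_I') auto
    next
      case False
      then show ?thesis by (simp add: zero_less_measure_iff)
    qed
  qed simp
  then show ?thesis
    by (rule AE_mp) (auto intro!: AE_I2 dest: measurable_space[OF lab])
qed

text \<open>On the product of cells \<open>i\<close> and \<open>j\<close> the coupling has density
  \<open>w i j / (m i * m' j)\<close> with respect to the product measure, so this rectangle
  receives mass \<open>w i j\<close>. The row and column sums then give back the two marginals, and
  replacing the cost by its bound \<open>K\<close> turns the integral into a double sum.\<close>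

lemma coupling_of_weights:
  fixes \<mu> \<nu> :: "'a::metric_space measure" and lab :: "'a \<Rightarrow> nat"
  assumes compact: "compact (UNIV :: 'a set)"
    and \<mu>: "\<mu> \<in> borel_probs" and \<nu>: "\<nu> \<in> borel_probs"
    and lab: "lab \<in> measurable borel (count_space {..<n})"
    and w: "\<And>i j. 0 \<le> w i j"
    and rows: "\<And>i. i < n \<Longrightarrow> (\<Sum>j<n. w i j) = measure \<mu> (lab -` {i})"
    and cols: "\<And>j. j < n \<Longrightarrow> (\<Sum>i<n. w i j) = measure \<nu> (lab -` {j})"
    and c: "(\<lambda>(x, y). c x y) \<in> borel_measurable borel"
    and K: "\<And>x y. c x y \<le> K (lab x) (lab y)" "\<And>i j. 0 \<le> K i j"
  shows "\<exists>\<gamma>\<in>couplings \<mu> \<nu>. (\<integral>\<^sup>+ (x, y). ennreal (c x y) \<partial>\<gamma>) \<le> ennreal (\<Sum>i<n. \<Sum>j<n. w i j * K i j)"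
proof -
  define m where "m i = measure \<mu> (lab -` {i})" for i
  define m' where "m' j = measure \<nu> (lab -` {j})" for j
  have [simp]: "sets \<mu> = sets borel" "space \<mu> = UNIV" "sets \<nu> = sets borel" "space \<nu> = UNIV"
    using \<mu> \<nu> sets_eq_imp_space_eq[of \<mu> borel] sets_eq_imp_space_eq[of \<nu> borel] by (auto simp: borel_probs_def)
  interpret M: prob_space \<mu> using \<mu> by (simp add: borel_probs_def)
  interpret N: prob_space \<nu> using \<nu> by (simp add: borel_probs_def)
  interpret MN: pair_sigma_finite \<mu> \<nu> ..
  have labM: "lab \<in> measurable \<mu> (count_space {..<n})" and labN: "lab \<in> measurable \<nu> (count_space {..<n})"
    using lab measurable_cong_sets[of \<mu> borel "count_space {..<n}" "count_space {..<n}"]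
      measurable_cong_sets[of \<nu> borel "count_space {..<n}" "count_space {..<n}"] by auto
  have lab_less: "lab x < n" for x using measurable_space[OF lab, of x] by simp
  have sets_MN: "sets (\<mu> \<Otimes>\<^sub>M \<nu>) = sets (borel :: ('a \<times> 'a) measure)"
  proof -
    have "sets (\<mu> \<Otimes>\<^sub>M \<nu>) = sets (borel \<Otimes>\<^sub>M borel)" by (intro sets_pair_measure_cong) simp_all
    then show ?thesis using sets_borel_pair_compact[OF compact] by simp
  qed
  \<comment> \<open>Rows and columns of zero mass carry no weight, so the default value
    \<open>x / 0 = 0\<close> in the density \<open>h\<close> loses no mass.\<close>
  have m0: "w i j = 0" if "i < n" "j < n" "m i = 0" for i j
    using rows[of i] that w sum_nonneg_eq_0_iff[of "{..<n}" "w i"] by (auto simp: m_def)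
  have m'0: "w i j = 0" if "i < n" "j < n" "m' j = 0" for i j
    using cols[of j] that w sum_nonneg_eq_0_iff[of "{..<n}" "\<lambda>i. w i j"] by (auto simp: m'_def)
  define h where "h = (\<lambda>(x, y). w (lab x) (lab y) / (m (lab x) * m' (lab y)))"
  have labfst: "(\<lambda>z. lab (fst z)) \<in> measurable (\<mu> \<Otimes>\<^sub>M \<nu>) (count_space {..<n})"
    and labsnd: "(\<lambda>z. lab (snd z)) \<in> measurable (\<mu> \<Otimes>\<^sub>M \<nu>) (count_space {..<n})"
    using labM labN by measurable
  have lab_meas2: "(\<lambda>z. F (lab (fst z)) (lab (snd z))) \<in> borel_measurable (\<mu> \<Otimes>\<^sub>M \<nu>)"
    for F :: "nat \<Rightarrow> nat \<Rightarrow> real"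
  proof -
    have "(\<lambda>z. (lab (fst z), lab (snd z))) \<in> measurable (\<mu> \<Otimes>\<^sub>M \<nu>) (count_space ({..<n} \<times> {..<n}))"
      using measurable_Pair[OF labfst labsnd] by (simp add: pair_measure_count_space)
    then have "(\<lambda>z. case (lab (fst z), lab (snd z)) of (i, j) \<Rightarrow> F i j) \<in> borel_measurable (\<mu> \<Otimes>\<^sub>M \<nu>)"
      by (rule measurable_compose) simp
    then show ?thesis by simp
  qed
  have h_meas: "(\<lambda>z. ennreal (h z)) \<in> borel_measurable (\<mu> \<Otimes>\<^sub>M \<nu>)"
    using lab_meas2[of "\<lambda>i j. w i j / (m i * m' j)"] by (simp add: h_def split_beta)
  have h_nonneg: "0 \<le> h z" for z using w by (auto simp: h_def m_def m'_def split: prod.splits)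
  define \<gamma> where "\<gamma> = density (\<mu> \<Otimes>\<^sub>M \<nu>) (\<lambda>z. ennreal (h z))"
  \<comment> \<open>Used with \<open>F\<close> constantly \<open>1\<close> for the first marginal
    and with \<open>F = K\<close> for the cost.\<close>
  have inner: "(\<integral>\<^sup>+ y. ennreal (F (lab x) (lab y) * h (x, y)) \<partial>\<nu>)
      = ennreal ((\<Sum>j<n. F (lab x) j * w (lab x) j) / m (lab x))"
    if F: "\<And>i j. 0 \<le> F i j" for x and F :: "nat \<Rightarrow> nat \<Rightarrow> real"
  proof -
    have "(\<integral>\<^sup>+ y. ennreal (F (lab x) (lab y) * h (x, y)) \<partial>\<nu>)
        = ennreal (\<Sum>j<n. (F (lab x) j * (w (lab x) j / (m (lab x) * m' j))) * m' j)"
      using nn_integral_label[OF N.prob_space_axioms labN, of "\<lambda>j. F (lab x) j * (w (lab x) j / (m (lab x) * m' j))"] w F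
      by (simp add: h_def m'_def m_def)
    also have "(\<Sum>j<n. (F (lab x) j * (w (lab x) j / (m (lab x) * m' j))) * m' j)
        = (\<Sum>j<n. (F (lab x) j * w (lab x) j) / m (lab x))"
      by (intro sum.cong refl) (use m'0[OF lab_less] in auto)
    also have "\<dots> = (\<Sum>j<n. F (lab x) j * w (lab x) j) / m (lab x)"
      by (simp add: sum_divide_distrib)
    finally show ?thesis .
  qed
  have inner': "(\<integral>\<^sup>+ x. ennreal (h (x, y)) \<partial>\<mu>) = ennreal ((\<Sum>i<n. w i (lab y)) / m' (lab y))" for y
  proof -
    have "(\<integral>\<^sup>+ x. ennreal (h (x, y)) \<partial>\<mu>)
        = ennreal (\<Sum>i<n. (w i (lab y) / (m i * m' (lab y))) * m i)"
      using nn_integral_label[OF M.prob_space_axioms labM, of "\<lambda>i. w i (lab y) / (m i * m' (lab y))"] w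
      by (simp add: h_def m'_def m_def)
    also have "(\<Sum>i<n. (w i (lab y) / (m i * m' (lab y))) * m i) = (\<Sum>i<n. w i (lab y) / m' (lab y))"
      by (intro sum.cong refl) (use m0[OF _ lab_less] in auto)
    also have "\<dots> = (\<Sum>i<n. w i (lab y)) / m' (lab y)"
      by (simp add: sum_divide_distrib)
    finally show ?thesis .
  qed
  have sets_\<gamma>: "sets \<gamma> = sets borel" unfolding \<gamma>_def sets_density by (rule sets_MN)
  have space_\<gamma>: "space \<gamma> = UNIV" using sets_eq_imp_space_eq[OF sets_\<gamma>] by simp
  have emb1: "fst -` A \<inter> space \<gamma> \<in> sets \<gamma>" "fst -` A \<in> sets (\<mu> \<Otimes>\<^sub>M \<nu>)" if "A \<in> sets borel" for A
    using measurable_sets[OF measurable_fst, of A \<mu> \<nu>] that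
    by (auto simp: space_\<gamma> \<gamma>_def space_pair_measure)
  have emb2: "snd -` A \<inter> space \<gamma> \<in> sets \<gamma>" "snd -` A \<in> sets (\<mu> \<Otimes>\<^sub>M \<nu>)" if "A \<in> sets borel" for A
    using measurable_sets[OF measurable_snd, of A \<mu> \<nu>] that
    by (auto simp: space_\<gamma> \<gamma>_def space_pair_measure)
  have fst_\<gamma>: "fst \<in> measurable \<gamma> borel" and snd_\<gamma>: "snd \<in> measurable \<gamma> borel"
    using emb1(1) emb2(1) by (auto intro!: measurableI simp: space_\<gamma>)
  have h_ind: "(\<lambda>z. ennreal (h z) * indicator B z) \<in> borel_measurable (\<mu> \<Otimes>\<^sub>M \<nu>)"
    if "B \<in> sets (\<mu> \<Otimes>\<^sub>M \<nu>)" for B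
    by (intro borel_measurable_times_ennreal h_meas borel_measurable_indicator that)
  have marg1: "distr \<gamma> borel fst = \<mu>"
  proof (rule measure_eqI)
    fix A assume "A \<in> sets (distr \<gamma> borel fst)"
    then have A: "A \<in> sets borel" by simp
    have "emeasure (distr \<gamma> borel fst) A = emeasure \<gamma> (fst -` A)"
      using A fst_\<gamma> by (simp add: emeasure_distr space_\<gamma>)
    also have "\<dots> = (\<integral>\<^sup>+ z. ennreal (h z) * indicator (fst -` A) z \<partial>(\<mu> \<Otimes>\<^sub>M \<nu>))"
      unfolding \<gamma>_def by (rule emeasure_density[OF h_meas emb1(2)[OF A]])
    also have "\<dots> = (\<integral>\<^sup>+ x. \<integral>\<^sup>+ y. ennreal (h (x, y)) * indicator (fst -` A) (x, y) \<partial>\<nu> \<partial>\<mu>)"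
      by (rule N.nn_integral_fst[symmetric, OF h_ind[OF emb1(2)[OF A]]])
    also have "\<dots> = (\<integral>\<^sup>+ x. (\<integral>\<^sup>+ y. ennreal (1 * h (x, y)) \<partial>\<nu>) * indicator A x \<partial>\<mu>)"
      by (intro nn_integral_cong) (auto simp: indicator_def)
    \<comment> \<open>The inner integral is \<open>1\<close> only at points whose cell has positive
      mass, so the integrands agree almost everywhere.\<close>
    also have "\<dots> = (\<integral>\<^sup>+ x. indicator A x \<partial>\<mu>)"
    proof (rule nn_integral_cong_AE)
      show "AE x in \<mu>. (\<integral>\<^sup>+ y. ennreal (1 * h (x, y)) \<partial>\<nu>) * indicator A x = indicator A x"
        using AE_label_pos[OF M.prob_space_axioms labM]
      proof (rule AE_mp, intro AE_I2 impI)
        fix x assume "0 < measure \<mu> (lab -` {lab x} \<inter> space \<mu>)"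
        then have "0 < m (lab x)" by (simp add: m_def)
        then show "(\<integral>\<^sup>+ y. ennreal (1 * h (x, y)) \<partial>\<nu>) * indicator A x = indicator A x"
          using inner[of "\<lambda>_ _. 1" x] rows[OF lab_less[of x]] by (simp add: m_def)
      qed
    qed
    finally show "emeasure (distr \<gamma> borel fst) A = emeasure \<mu> A" using A by simp
  qed simp
  have marg2: "distr \<gamma> borel snd = \<nu>"
  proof (rule measure_eqI)
    fix A assume "A \<in> sets (distr \<gamma> borel snd)"
    then have A: "A \<in> sets borel" by simp
    have "emeasure (distr \<gamma> borel snd) A = emeasure \<gamma> (snd -` A)"
      using A snd_\<gamma> by (simp add: emeasure_distr space_\<gamma>)
    also have "\<dots> = (\<integral>\<^sup>+ z. ennreal (h z) * indicator (snd -` A) z \<partial>(\<mu> \<Otimes>\<^sub>M \<nu>))"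
      unfolding \<gamma>_def by (rule emeasure_density[OF h_meas emb2(2)[OF A]])
    also have "\<dots> = (\<integral>\<^sup>+ y. \<integral>\<^sup>+ x. ennreal (h (x, y)) * indicator (snd -` A) (x, y) \<partial>\<mu> \<partial>\<nu>)"
      by (rule MN.nn_integral_snd[symmetric, OF h_ind[OF emb2(2)[OF A]]])
    also have "\<dots> = (\<integral>\<^sup>+ y. (\<integral>\<^sup>+ x. ennreal (h (x, y)) \<partial>\<mu>) * indicator A y \<partial>\<nu>)"
      by (intro nn_integral_cong) (auto simp: indicator_def)
    also have "\<dots> = (\<integral>\<^sup>+ x. indicator A x \<partial>\<nu>)"
    proof (rule nn_integral_cong_AE)
      show "AE y in \<nu>. (\<integral>\<^sup>+ x. ennreal (h (x, y)) \<partial>\<mu>) * indicator A y = indicator A y"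
        using AE_label_pos[OF N.prob_space_axioms labN]
      proof (rule AE_mp, intro AE_I2 impI)
        fix y assume "0 < measure \<nu> (lab -` {lab y} \<inter> space \<nu>)"
        then have "0 < m' (lab y)" by (simp add: m'_def)
        then show "(\<integral>\<^sup>+ x. ennreal (h (x, y)) \<partial>\<mu>) * indicator A y = indicator A y"
          using inner'[of y] cols[OF lab_less[of y]] by (simp add: m'_def)
      qed
    qed
    finally show "emeasure (distr \<gamma> borel snd) A = emeasure \<nu> A" using A by simp
  qed simp
  have "emeasure \<gamma> (space \<gamma>) = emeasure (distr \<gamma> borel fst) UNIV"
    using fst_\<gamma> by (subst emeasure_distr) auto
  then have "prob_space \<gamma>"
    using M.emeasure_space_1 by (intro prob_spaceI) (simp add: marg1)
  then have "\<gamma> \<in> couplings \<mu> \<nu>"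
    by (simp add: couplings_def borel_probs_def sets_\<gamma> marg1 marg2)
  moreover have "(\<integral>\<^sup>+ (x, y). ennreal (c x y) \<partial>\<gamma>) \<le> ennreal (\<Sum>i<n. \<Sum>j<n. w i j * K i j)"
  proof -
    have c': "(\<lambda>z. ennreal (c (fst z) (snd z))) \<in> borel_measurable (\<mu> \<Otimes>\<^sub>M \<nu>)"
    proof -
      have "(\<lambda>(x, y). c x y) \<in> borel_measurable (\<mu> \<Otimes>\<^sub>M \<nu>)"
        by (subst measurable_cong_sets[OF sets_MN refl]) (rule c)
      from measurable_compose[OF this measurable_ennreal] show ?thesis by (simp add: split_beta)
    qed
    have "(\<integral>\<^sup>+ (x, y). ennreal (c x y) \<partial>\<gamma>)
        = (\<integral>\<^sup>+ z. ennreal (h z) * ennreal (c (fst z) (snd z)) \<partial>(\<mu> \<Otimes>\<^sub>M \<nu>))"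
      unfolding \<gamma>_def split_beta using h_meas c' by (subst nn_integral_density) auto
    also have "\<dots> \<le> (\<integral>\<^sup>+ z. ennreal (K (lab (fst z)) (lab (snd z)) * h z) \<partial>(\<mu> \<Otimes>\<^sub>M \<nu>))"
      using K h_nonneg
      by (intro nn_integral_mono) (auto simp: ennreal_mult mult.commute intro!: mult_left_mono ennreal_leI)
    also have "\<dots> = (\<integral>\<^sup>+ x. \<integral>\<^sup>+ y. ennreal (K (lab x) (lab y) * h (x, y)) \<partial>\<nu> \<partial>\<mu>)"
    proof -
      have "(\<lambda>z. ennreal (K (lab (fst z)) (lab (snd z)) * h z)) \<in> borel_measurable (\<mu> \<Otimes>\<^sub>M \<nu>)"
        using lab_meas2[of "\<lambda>i j. K i j * (w i j / (m i * m' j))"] by (simp add: h_def split_beta)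
      then show ?thesis by (subst N.nn_integral_fst[symmetric]) auto
    qed
    also have "\<dots> = (\<integral>\<^sup>+ x. ennreal ((\<Sum>j<n. K (lab x) j * w (lab x) j) / m (lab x)) \<partial>\<mu>)"
      using inner K by simp
    also have "\<dots> = ennreal (\<Sum>i<n. ((\<Sum>j<n. K i j * w i j) / m i) * m i)"
      using nn_integral_label[OF M.prob_space_axioms labM, of "\<lambda>i. (\<Sum>j<n. K i j * w i j) / m i"] K w
      by (simp add: m_def sum_nonneg)
    also have "(\<Sum>i<n. ((\<Sum>j<n. K i j * w i j) / m i) * m i) = (\<Sum>i<n. \<Sum>j<n. w i j * K i j)"
      by (intro sum.cong refl) (auto simp: m0 mult.commute)
    finally show ?thesis .
  qed
  ultimately show ?thesis by blast
qed

section \<open>Covers of the Wasserstein space\<close>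

text \<open>The mass common to both measures in a cell is moved inside that cell, at cost at most
  \<open>a powr p\<close> per unit. What remains has total mass at most \<open>n * \<eta>\<close>
  and travels at most \<open>D\<close>.\<close>

lemma transport_cost_le_of_close_masses:
  fixes \<mu> \<nu> :: "'a::metric_space measure" and lab :: "'a \<Rightarrow> nat"
  assumes compact: "compact (UNIV :: 'a set)"
    and \<mu>: "\<mu> \<in> borel_probs" and \<nu>: "\<nu> \<in> borel_probs"
    and lab: "lab \<in> measurable borel (count_space {..<n})"
    and "0 \<le> p"
    and same: "\<And>x y. lab x = lab y \<Longrightarrow> dist x y \<le> a"
    and D: "\<And>x y :: 'a. dist x y \<le> D"
    and close: "\<And>i. i < n \<Longrightarrow> \<bar>measure \<mu> (lab -` {i}) - measure \<nu> (lab -` {i})\<bar> \<le> \<eta>"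
  shows "(INF \<gamma>\<in>couplings \<mu> \<nu>. \<integral>\<^sup>+ (x, y). ennreal (dist x y powr p) \<partial>\<gamma>)
    \<le> ennreal (a powr p + D powr p * (real n * \<eta>))"
proof -
  define m where "m i = measure \<mu> (lab -` {i})" for i
  define m' where "m' i = measure \<nu> (lab -` {i})" for i
  define c where "c i = min (m i) (m' i)" for i
  define r where "r = (\<Sum>i<n. m i - c i)"
  interpret M: prob_space \<mu> using \<mu> by (simp add: borel_probs_def)
  interpret N: prob_space \<nu> using \<nu> by (simp add: borel_probs_def)
  have [simp]: "space \<mu> = UNIV" "space \<nu> = UNIV"
    using \<mu> \<nu> sets_eq_imp_space_eq[of \<mu> borel] sets_eq_imp_space_eq[of \<nu> borel] by (auto simp: borel_probs_def)
  have labM: "lab \<in> measurable \<mu> (count_space {..<n})" and labN: "lab \<in> measurable \<nu> (count_space {..<n})"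
    using lab \<mu> \<nu> measurable_cong_sets[of \<mu> borel "count_space {..<n}" "count_space {..<n}"]
      measurable_cong_sets[of \<nu> borel "count_space {..<n}" "count_space {..<n}"] by (auto simp: borel_probs_def)
  have total: "(\<Sum>i<n. m i) = 1" "(\<Sum>i<n. m' i) = 1"
    using nn_integral_label[OF M.prob_space_axioms labM, of "\<lambda>_. 1"] M.emeasure_space_1
      nn_integral_label[OF N.prob_space_axioms labN, of "\<lambda>_. 1"] N.emeasure_space_1
    by (simp_all add: m_def m'_def)
  \<comment> \<open>Both measures have total mass \<open>1\<close>, so each exceeds the common part
    by the same amount \<open>r\<close>; this gives the product weights below the right row and
    column sums.\<close>
  have r': "r = (\<Sum>i<n. m' i - c i)" by (simp add: r_def sum_subtractf total)
  have c: "0 \<le> c i" "c i \<le> m i" "c i \<le> m' i" for i by (auto simp: c_def m_def m'_def)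
  have r0: "0 \<le> r" using c by (auto simp: r_def intro!: sum_nonneg)
  have r_zero: "m i = c i" "m' i = c i" if "r = 0" "i < n" for i
  proof -
    have "m i - c i = 0" using that(1) c unfolding r_def by (subst (asm) sum_nonneg_eq_0_iff) (use that in auto)
    then show "m i = c i" by simp
    have "m' i - c i = 0" using that(1) c unfolding r' by (subst (asm) sum_nonneg_eq_0_iff) (use that in auto)
    then show "m' i = c i" by simp
  qed
  txt \<open>Leave the common mass in place and spread the rest proportionally; if \<open>r = 0\<close> there is no rest
    and the quotient is \<open>0\<close>.\<close>
  define w where "w i j = (if i = j then c i else 0) + (m i - c i) * (m' j - c j) / r" for i j
  have w0: "0 \<le> w i j" for i j using c r0 by (auto simp: w_def)
  have rows: "(\<Sum>j<n. w i j) = m i" if "i < n" for i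
  proof -
    have "(\<Sum>j<n. w i j) = c i + (m i - c i) * r / r"
      using that by (simp add: w_def sum.distrib r' sum_distrib_left sum_divide_distrib)
    then show ?thesis using r_zero[OF _ that] by (cases "r = 0") auto
  qed
  have cols: "(\<Sum>i<n. w i j) = m' j" if "j < n" for j
  proof -
    have "(\<Sum>i<n. w i j) = c j + r * (m' j - c j) / r"
      using that by (simp add: w_def sum.distrib r_def sum_distrib_right sum_divide_distrib)
    then show ?thesis using r_zero[OF _ that] by (cases "r = 0") auto
  qed
  \<comment> \<open>Every pair pays \<open>a powr p\<close>, also off the diagonal; since the
    weights sum to \<open>1\<close>, this adds only \<open>a powr p\<close> in total.\<close>
  define K where "K i j = a powr p + D powr p * (if i = j then 0 else 1)" for i j :: nat
  have "(\<lambda>z :: 'a \<times> 'a. dist (fst z) (snd z)) \<in> borel_measurable borel"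
    by (intro borel_measurable_continuous_onI continuous_intros)
  then have meas: "(\<lambda>(x :: 'a, y). dist x y powr p) \<in> borel_measurable borel"
    unfolding split_beta by measurable
  have "\<exists>\<gamma>\<in>couplings \<mu> \<nu>. (\<integral>\<^sup>+ (x, y). ennreal (dist x y powr p) \<partial>\<gamma>)
      \<le> ennreal (\<Sum>i<n. \<Sum>j<n. w i j * K i j)"
  proof (rule coupling_of_weights[OF compact \<mu> \<nu> lab w0])
    show "dist x y powr p \<le> K (lab x) (lab y)" for x y
      using same[of x y] D[of x y] \<open>0 \<le> p\<close>
      by (auto simp: K_def intro!: powr_mono2 order_trans[OF powr_mono2[of p "dist x y" D]])
    show "0 \<le> K i j" for i j by (simp add: K_def)
  qed (use rows cols meas in \<open>auto simp: m_def m'_def\<close>)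
  then have "(INF \<gamma>\<in>couplings \<mu> \<nu>. \<integral>\<^sup>+ (x, y). ennreal (dist x y powr p) \<partial>\<gamma>)
      \<le> ennreal (\<Sum>i<n. \<Sum>j<n. w i j * K i j)"
    by (auto intro: INF_lower2)
  also have "(\<Sum>i<n. \<Sum>j<n. w i j * K i j) \<le> a powr p + D powr p * (real n * \<eta>)"
  proof -
    have "(\<Sum>i<n. \<Sum>j<n. w i j * K i j)
        = (\<Sum>i<n. \<Sum>j<n. a powr p * w i j + D powr p * (w i j - (if i = j then w i j else 0)))"
      by (intro sum.cong refl) (auto simp: K_def algebra_simps)
    also have "\<dots> = (\<Sum>i<n. a powr p * m i + D powr p * (m i - w i i))"
      using rows by (intro sum.cong refl) (simp add: sum.distrib sum_subtractf flip: sum_distrib_left)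
    also have "\<dots> = a powr p + D powr p * (\<Sum>i<n. m i - w i i)"
      using total by (simp add: sum.distrib flip: sum_distrib_left)
    also have "(\<Sum>i<n. m i - w i i) \<le> (\<Sum>i<n. \<eta>)"
    proof (rule sum_mono)
      fix i assume "i \<in> {..<n}"
      then have "m i - c i \<le> \<eta>" using close[of i] by (auto simp: c_def m_def m'_def)
      moreover have "c i \<le> w i i" using c r0 by (simp add: w_def)
      ultimately show "m i - w i i \<le> \<eta>" by simp
    qed
    finally show ?thesis by (simp add: mult_left_mono)
  qed
  finally show ?thesis by (simp add: ennreal_leI)
qed

text \<open>A finite cover extends to a sequence by empty sets, which are free because
  \<open>f 0 = 0\<close>; each of the \<open>M\<close> genuine sets costs at most
  \<open>f \<rho>\<close>.\<close>

lemma cover_content_le: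
  assumes Z: "(\<Union>i<M. E i) = Z" and le: "\<And>i x y. i < M \<Longrightarrow> x \<in> E i \<Longrightarrow> y \<in> E i \<Longrightarrow> d x y \<le> \<rho>"
    and "0 \<le> \<rho>" "\<rho> \<le> \<delta>" and f0: "f 0 = 0" and mono: "\<And>x. 0 \<le> x \<Longrightarrow> x \<le> \<rho> \<Longrightarrow> f x \<le> f \<rho>"
  shows "cover_content f Z d \<delta> \<le> ennreal (real M * f \<rho>)"
proof -
  define F where "F i = (if i < M then E i else {})" for i
  have diam: "diam_on d (F i) \<le> ennreal \<rho>" for i
    unfolding diam_on_def F_def using le by (auto intro!: SUP_least ennreal_leI)
  have "F \<in> fine_covers Z d \<delta>"
    using Z order_trans[OF diam ennreal_leI[OF \<open>\<rho> \<le> \<delta>\<close>]]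
    by (auto simp: fine_covers_def F_def split: if_splits)
  then have "cover_content f Z d \<delta> \<le> (\<Sum>i. ennreal (f (enn2real (diam_on d (F i)))))"
    unfolding cover_content_def by (rule INF_lower)
  also have "\<dots> = (\<Sum>i<M. ennreal (f (enn2real (diam_on d (F i)))))"
    by (rule suminf_finite) (auto simp: F_def diam_on_def f0 bot_ennreal)
  also have "\<dots> \<le> (\<Sum>i<M. ennreal (f \<rho>))"
  proof (intro sum_mono ennreal_leI mono)
    show "enn2real (diam_on d (F i)) \<le> \<rho>" for i
      using enn2real_mono[OF diam[of i]] \<open>0 \<le> \<rho>\<close> by simp
  qed simp
  also have "\<dots> = ennreal (real M * f \<rho>)"
    using mono[of 0] f0 \<open>0 \<le> \<rho>\<close> by (simp add: ennreal_mult ennreal_of_nat_eq_real_of_nat)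
  finally show ?thesis .
qed

lemma pexp_gauge_mono: "x \<le> y \<Longrightarrow> 0 < s \<Longrightarrow> pexp_gauge s x \<le> pexp_gauge s y"
proof (cases "0 < x")
  case True
  assume "x \<le> y" "0 < s"
  then have "x powr s \<le> y powr s" using True by (intro powr_mono2) auto
  then show ?thesis using True \<open>x \<le> y\<close> by (auto simp: pexp_gauge_def intro!: divide_left_mono)
qed (simp add: pexp_gauge_def)

section \<open>Covers obtained by rounding the masses of cells\<close>

lemma covering_number_works:
  fixes \<epsilon> :: real
  assumes "compact (UNIV :: 'a::metric_space set)" "0 < \<epsilon>"
  obtains C :: "'a::metric_space set" where "finite C" "card C = covering_number (UNIV :: 'a set) \<epsilon>"
    "UNIV = (\<Union>c\<in>C. ball c \<epsilon>)"
proof -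
  have "\<exists>n. \<exists>C \<subseteq> (UNIV :: 'a set). finite C \<and> card C = n \<and> UNIV \<subseteq> (\<Union>c\<in>C. ball c \<epsilon>)"
    using finite_ball_cover[OF assms] by blast
  from LeastI_ex[OF this] show ?thesis
    using that unfolding covering_number_def by blast
qed

text \<open>Measures are sorted by the masses of \<open>N\<close> cells, rounded down to multiples
  of \<open>1 / m\<close>. Each mass has at most \<open>m + 1\<close> rounded values, and two
  measures with equal rounding differ by at most \<open>1 / m\<close> on every cell. The condition
  on \<open>m\<close> makes the cost of this discrepancy at most
  \<open>\<epsilon> powr p\<close>.\<close>

lemma wasserstein_cover:
  fixes \<epsilon> D p :: real
  assumes compact: "compact (UNIV :: 'a::metric_space set)" and "1 \<le> p" and "0 < \<epsilon>"
    and D: "\<And>x y :: 'a. dist x y \<le> D"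
    and N: "N = covering_number (UNIV :: 'a set) \<epsilon>"
    and m: "D powr p * real N \<le> real m * \<epsilon> powr p" "0 < m"
  obtains E :: "nat \<Rightarrow> 'a::metric_space measure set" where "(\<Union>i<(m + 1) ^ N. E i) = borel_probs"
    "\<And>i \<mu> \<nu>. i < (m + 1) ^ N \<Longrightarrow> \<mu> \<in> E i \<Longrightarrow> \<nu> \<in> E i \<Longrightarrow> wasserstein_dist p \<mu> \<nu> \<le> 3 * \<epsilon>"
proof -
  obtain C :: "'a set" where C: "finite C" "card C = N" "UNIV = (\<Union>c\<in>C. ball c \<epsilon>)"
    using covering_number_works[OF compact \<open>0 < \<epsilon>\<close>] N by metis
  obtain h where h: "bij_betw h {..<N} C"
    using ex_bij_betw_nat_finite[OF C(1)] C(2) by (auto simp: atLeast0LessThan)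
  \<comment> \<open>Choosing the first ball that contains the point turns the cover into a
    partition: each cell is a ball minus the earlier balls, hence Borel.\<close>
  define lab where "lab x = (LEAST i. i < N \<and> x \<in> ball (h i) \<epsilon>)" for x
  have ex: "\<exists>i. i < N \<and> x \<in> ball (h i) \<epsilon>" for x
  proof -
    obtain c where "c \<in> C" "x \<in> ball c \<epsilon>" using C(3) by blast
    moreover have "c \<in> h ` {..<N}" using \<open>c \<in> C\<close> h by (simp add: bij_betw_def)
    ultimately show ?thesis by auto
  qed
  have lab: "lab x < N" "x \<in> ball (h (lab x)) \<epsilon>" for x
    using LeastI_ex[OF ex[of x]] by (auto simp: lab_def)
  have lab_meas: "lab \<in> measurable borel (count_space {..<N})"
  proof (rule measurable_count_space_eq2[THEN iffD2])
    have "lab -` {i} = ball (h i) \<epsilon> - (\<Union>j<i. ball (h j) \<epsilon>)" if "i < N" for i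
    proof
      show "lab -` {i} \<subseteq> ball (h i) \<epsilon> - (\<Union>j<i. ball (h j) \<epsilon>)"
      proof
        fix x assume "x \<in> lab -` {i}"
        then have i: "lab x = i" by simp
        have "x \<notin> ball (h j) \<epsilon>" if "j < i" for j
          using not_less_Least[of j "\<lambda>i. i < N \<and> x \<in> ball (h i) \<epsilon>"] that i lab(1)[of x] by (auto simp: lab_def)
        then show "x \<in> ball (h i) \<epsilon> - (\<Union>j<i. ball (h j) \<epsilon>)" using lab(2)[of x] i by auto
      qed
      show "ball (h i) \<epsilon> - (\<Union>j<i. ball (h j) \<epsilon>) \<subseteq> lab -` {i}"
      proof
        fix x assume x: "x \<in> ball (h i) \<epsilon> - (\<Union>j<i. ball (h j) \<epsilon>)"
        then have "lab x = i" unfolding lab_def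
          by (intro Least_equality) (use that in \<open>auto simp: not_less[symmetric]\<close>)
        then show "x \<in> lab -` {i}" by simp
      qed
    qed
    moreover have "ball (h i) \<epsilon> - (\<Union>j<i. ball (h j) \<epsilon>) \<in> sets borel" for i by measurable
    ultimately have "lab -` {i} \<in> sets borel" if "i < N" for i using that by metis
    then show "lab \<in> space borel \<rightarrow> {..<N} \<and> (\<forall>i\<in>{..<N}. lab -` {i} \<inter> space borel \<in> sets borel)"
      using lab(1) by auto
  qed simp
  have same: "dist x y \<le> 2 * \<epsilon>" if "lab x = lab y" for x y
    using lab(2)[of x] lab(2)[of y] that dist_triangle[of x y "h (lab x)"] by (auto simp: dist_commute)
  define I where "I = (\<Pi>\<^sub>E i\<in>{..<N}. {..m})"
  define key where "key \<mu> = (\<lambda>i\<in>{..<N}. nat \<lfloor>real m * measure \<mu> (lab -` {i})\<rfloor>)" for \<mu> :: "'a measure"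
  have "card I = (m + 1) ^ N" "finite I" by (simp_all add: I_def card_PiE finite_PiE)
  then obtain g where g: "bij_betw g {..<(m + 1) ^ N} I"
    using ex_bij_betw_nat_finite[of I] by (auto simp: atLeast0LessThan)
  define E where "E i = {\<mu> \<in> borel_probs. key \<mu> = g i}" for i
  have key_in: "key \<mu> \<in> I" if "\<mu> \<in> borel_probs" for \<mu>
  proof -
    interpret prob_space \<mu> using that by (simp add: borel_probs_def)
    have "nat \<lfloor>real m * measure \<mu> A\<rfloor> \<le> m" for A
    proof -
      have "real m * measure \<mu> A \<le> real m" using prob_le_1[of A] by (simp add: mult_left_le)
      then show ?thesis by linarith
    qed
    then show ?thesis by (auto simp: I_def key_def)
  qed
  have "(\<Union>i<(m + 1) ^ N. E i) = borel_probs"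
  proof
    show "borel_probs \<subseteq> (\<Union>i<(m + 1) ^ N. E i)"
    proof
      fix \<mu> :: "'a measure" assume \<mu>: "\<mu> \<in> borel_probs"
      have "key \<mu> \<in> g ` {..<(m + 1) ^ N}" using key_in[OF \<mu>] g by (simp add: bij_betw_def)
      then show "\<mu> \<in> (\<Union>i<(m + 1) ^ N. E i)" using \<mu> by (auto simp: E_def)
    qed
  qed (auto simp: E_def)
  moreover have "wasserstein_dist p \<mu> \<nu> \<le> 3 * \<epsilon>" if "\<mu> \<in> E i" "\<nu> \<in> E i" for i \<mu> \<nu>
  proof -
    have \<mu>: "\<mu> \<in> borel_probs" and \<nu>: "\<nu> \<in> borel_probs" and key: "key \<mu> = key \<nu>"
      using that by (auto simp: E_def)
    have close: "\<bar>measure \<mu> (lab -` {j}) - measure \<nu> (lab -` {j})\<bar> \<le> 1 / real m" if "j < N" for j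
    proof -
      have "nat \<lfloor>real m * measure \<mu> (lab -` {j})\<rfloor> = nat \<lfloor>real m * measure \<nu> (lab -` {j})\<rfloor>"
        using fun_cong[OF key, of j] that by (simp add: key_def)
      then have "\<lfloor>real m * measure \<mu> (lab -` {j})\<rfloor> = \<lfloor>real m * measure \<nu> (lab -` {j})\<rfloor>"
        by (simp add: eq_nat_nat_iff)
      then have "\<bar>real m * measure \<mu> (lab -` {j}) - real m * measure \<nu> (lab -` {j})\<bar> \<le> 1" by linarith
      then have "real m * \<bar>measure \<mu> (lab -` {j}) - measure \<nu> (lab -` {j})\<bar> \<le> 1"
        by (metis abs_mult abs_of_nat right_diff_distrib)
      then show ?thesis using \<open>0 < m\<close> by (simp add: field_simps)
    qed
    have "(INF \<gamma>\<in>couplings \<mu> \<nu>. \<integral>\<^sup>+ (x, y). ennreal (dist x y powr p) \<partial>\<gamma>)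
        \<le> ennreal ((2 * \<epsilon>) powr p + D powr p * (real N * (1 / real m)))"
      by (rule transport_cost_le_of_close_masses[OF compact \<mu> \<nu> lab_meas _ same D close])
        (use \<open>1 \<le> p\<close> \<open>0 < \<epsilon>\<close> in auto)
    also have "\<dots> \<le> ennreal ((3 * \<epsilon>) powr p)"
    proof (rule ennreal_leI)
      have "D powr p * (real N * (1 / real m)) \<le> \<epsilon> powr p"
        using m by (simp add: field_simps)
      \<comment> \<open>Source of the factor \<open>3\<close>: the costs
        \<open>(2 * \<epsilon>) powr p\<close> within cells and \<open>\<epsilon> powr p\<close> for
        the discrepancy add up to at most \<open>(3 * \<epsilon>) powr p\<close>. After division by
        \<open>3 powr p\<close> this follows from \<open>x powr p \<le> x\<close> at
        \<open>2/3\<close> and \<open>1/3\<close>.\<close>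
      moreover have "(2::real) powr p + 1 \<le> 3 powr p"
      proof -
        have "(2/3::real) powr p + (1/3) powr p \<le> (2/3) powr 1 + (1/3) powr 1"
          using \<open>1 \<le> p\<close> by (intro add_mono powr_mono') auto
        then show ?thesis by (simp add: powr_divide field_simps)
      qed
      then have "(2 powr p + 1) * \<epsilon> powr p \<le> 3 powr p * \<epsilon> powr p" by (intro mult_right_mono) auto
      ultimately show "(2 * \<epsilon>) powr p + D powr p * (real N * (1 / real m)) \<le> (3 * \<epsilon>) powr p"
        using \<open>0 < \<epsilon>\<close> by (simp add: powr_mult algebra_simps)
    qed
    finally have "enn2real (INF \<gamma>\<in>couplings \<mu> \<nu>. \<integral>\<^sup>+ (x, y). ennreal (dist x y powr p) \<partial>\<gamma>) \<le> (3 * \<epsilon>) powr p"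
      by (intro enn2real_leI) auto
    then have "wasserstein_dist p \<mu> \<nu> \<le> ((3 * \<epsilon>) powr p) powr (1 / p)"
      unfolding wasserstein_dist_def using \<open>1 \<le> p\<close> by (intro powr_mono2) auto
    also have "\<dots> = 3 * \<epsilon>" using \<open>1 \<le> p\<close> \<open>0 < \<epsilon>\<close> by (simp add: powr_powr)
    finally show ?thesis .
  qed
  ultimately show ?thesis by (rule that)
qed

lemma compact_UNIV_dist_bound:
  assumes "compact (UNIV :: 'a::metric_space set)"
  obtains D where "1 \<le> D" "\<And>x y :: 'a. dist x y \<le> D"
proof -
  obtain x0 :: 'a and e where e: "\<And>y. dist x0 y \<le> e"
    using compact_imp_bounded[OF assms] by (auto simp: bounded_def)
  have "dist x y \<le> max 1 (2 * e)" for x y :: 'a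
    using dist_triangle[of x y x0] e[of x] e[of y] by (simp add: dist_commute)
  then show ?thesis using that[of "max 1 (2 * e)"] by auto
qed

text \<open>The first term of the exponent bounds the logarithm of the number of covering sets, the
  second comes from the gauge at diameter \<open>3 * \<epsilon>\<close>. Since \<open>t < s\<close>,
  the logarithmic factor cannot make up for the gap between the two powers.\<close>

lemma tendsto_cover_bound:
  fixes s t p A :: real
  assumes "0 < t" "t < s" "1 \<le> p" "0 < A"
  shows "((\<lambda>\<epsilon>. exp (\<epsilon> powr -t * ln (A * \<epsilon> powr -(t + p) + 3) - 1 / (3 * \<epsilon>) powr s)) \<longlongrightarrow> 0) (at_right 0)"
  using assms by real_asymp

text \<open>If \<open>s\<close> exceeds the upper Minkowski dimension, take \<open>t\<close>
  strictly between them. The covering number is eventually at most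
  \<open>\<epsilon> powr -t\<close>, so the covers by rounded masses have content tending to
  \<open>0\<close>.\<close>

lemma crit_pexp_wasserstein_le:
  fixes p :: real
  assumes compact: "compact (UNIV :: 'a::metric_space set)" and "1 \<le> p"
  shows "crit_pexp (borel_probs :: 'a measure set) (wasserstein_dist p) \<le> upper_minkowski_dim (UNIV :: 'a set)"
  unfolding crit_pexp_def critical_parameter_def
proof (rule SUP_least, rule ccontr)
  fix s assume "s \<in> {s. 0 < s \<and> 0 < gauge_measure (pexp_gauge s) (borel_probs :: 'a measure set) (wasserstein_dist p)}"
  then have "0 < s" and pos: "0 < gauge_measure (pexp_gauge s) (borel_probs :: 'a measure set) (wasserstein_dist p)"
    by auto
  assume "\<not> ennreal s \<le> upper_minkowski_dim (UNIV :: 'a set)"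
  then have "upper_minkowski_dim (UNIV :: 'a set) < ennreal s" by simp
  then obtain t' where t': "upper_minkowski_dim (UNIV :: 'a set) < t'" "t' < ennreal s"
    using dense by blast
  define t where "t = enn2real t'"
  have tt': "t' = ennreal t" using t'(2) by (cases t') (auto simp: t_def)
  have "0 < t'" using t'(1) by (rule le_less_trans[rotated]) simp
  then have "0 < t" using tt' by simp
  have "t < s" using t'(2) tt' \<open>0 < t\<close> by (simp add: ennreal_less_iff)
  obtain D where D: "1 \<le> D" "\<And>x y :: 'a. dist x y \<le> D"
    using compact_UNIV_dist_bound[OF compact] by blast
  define G where "G \<epsilon> = exp (\<epsilon> powr -t * ln (D powr p * \<epsilon> powr -(t + p) + 3) - 1 / (3 * \<epsilon>) powr s)" for \<epsilon> :: real
  have G: "(G \<longlongrightarrow> 0) (at_right 0)"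
    unfolding G_def using D(1) \<open>0 < t\<close> \<open>t < s\<close> \<open>1 \<le> p\<close> by (intro tendsto_cover_bound) auto
  \<comment> \<open>The left side does not involve \<open>\<epsilon>\<close>, so letting
    \<open>\<epsilon>\<close> tend to \<open>0\<close> in the bound from the covers yields
    \<open>0\<close>.\<close>
  have "cover_content (pexp_gauge s) (borel_probs :: 'a measure set) (wasserstein_dist p) \<delta> \<le> 0" if "0 < \<delta>" for \<delta>
  proof (rule tendsto_lowerbound)
    show "((\<lambda>\<epsilon>. ennreal (G \<epsilon>)) \<longlongrightarrow> 0) (at_right 0)"
      using tendsto_ennrealI[OF G] by simp
    have "\<forall>\<^sub>F \<epsilon> in at_right 0. ennreal (ln (real (covering_number (UNIV :: 'a set) \<epsilon>)) / ln (1 / \<epsilon>)) < ennreal t"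
      using t'(1) unfolding upper_minkowski_dim_def tt' by (rule Limsup_lessD)
    moreover have "\<forall>\<^sub>F \<epsilon> in at_right 0. 0 < \<epsilon> \<and> \<epsilon> < 1 \<and> 3 * \<epsilon> < \<delta>"
      using \<open>0 < \<delta>\<close> by (auto simp: eventually_at_right intro!: exI[of _ "min 1 (\<delta> / 3)"])
    ultimately show "\<forall>\<^sub>F \<epsilon> in at_right 0. cover_content (pexp_gauge s) (borel_probs :: 'a measure set) (wasserstein_dist p) \<delta> \<le> ennreal (G \<epsilon>)"
    proof eventually_elim
      case (elim \<epsilon>)
      then have \<epsilon>: "0 < \<epsilon>" "\<epsilon> < 1" "3 * \<epsilon> \<le> \<delta>" by auto
      define N where "N = covering_number (UNIV :: 'a set) \<epsilon>"
      obtain C :: "'a set" where C: "finite C" "card C = N" "UNIV = (\<Union>c\<in>C. ball c \<epsilon>)"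
        using covering_number_works[OF compact \<epsilon>(1)] N_def by metis
      have "0 < N" using C by (cases "N = 0") auto
      have "ln (real N) / ln (1 / \<epsilon>) < t"
        using elim(1) unfolding N_def by (metis ennreal_leI linorder_not_less)
      then have "ln (real N) \<le> t * ln (1 / \<epsilon>)" using \<epsilon> by (simp add: field_simps)
      then have "exp (ln (real N)) \<le> exp (t * ln (1 / \<epsilon>))" by simp
      also have "\<dots> = \<epsilon> powr -t" using \<epsilon> by (simp add: powr_def ln_div)
      finally have N_le: "real N \<le> \<epsilon> powr -t" using \<open>0 < N\<close> by simp
      \<comment> \<open>The summand \<open>1\<close> guarantees \<open>0 < m\<close>; together with
        the loss from rounding up it leads to the constant \<open>3\<close> in the bound on
        \<open>m + 1\<close>.\<close>
      define m where "m = nat \<lceil>D powr p * real N / \<epsilon> powr p\<rceil> + 1"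
      have m_ge: "D powr p * real N / \<epsilon> powr p \<le> real m" unfolding m_def by linarith
      have "real m \<le> D powr p * real N / \<epsilon> powr p + 2"
      proof -
        have "0 \<le> D powr p * real N / \<epsilon> powr p" by simp
        then show ?thesis unfolding m_def by linarith
      qed
      also have "\<dots> \<le> D powr p * \<epsilon> powr -t / \<epsilon> powr p + 2"
        using N_le \<epsilon> by (intro add_right_mono divide_right_mono mult_left_mono) auto
      also have "\<dots> = D powr p * \<epsilon> powr -(t + p) + 2"
        using powr_diff[of \<epsilon> "-t" p] by simp
      finally have m_le: "real m + 1 \<le> D powr p * \<epsilon> powr -(t + p) + 3" by simp
      obtain E :: "nat \<Rightarrow> 'a measure set" where E: "(\<Union>i<(m + 1) ^ N. E i) = borel_probs"
        "\<And>i \<mu> \<nu>. i < (m + 1) ^ N \<Longrightarrow> \<mu> \<in> E i \<Longrightarrow> \<nu> \<in> E i \<Longrightarrow> wasserstein_dist p \<mu> \<nu> \<le> 3 * \<epsilon>"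
      proof (rule wasserstein_cover[OF compact \<open>1 \<le> p\<close> \<epsilon>(1) D(2) N_def, of m])
        show "D powr p * real N \<le> real m * \<epsilon> powr p" using m_ge \<epsilon> by (simp add: field_simps)
        show "0 < m" by (simp add: m_def)
      qed blast
      have "cover_content (pexp_gauge s) (borel_probs :: 'a measure set) (wasserstein_dist p) \<delta>
          \<le> ennreal (real ((m + 1) ^ N) * pexp_gauge s (3 * \<epsilon>))"
        using E \<epsilon> \<open>0 < s\<close>
        by (intro cover_content_le[where E = E]) (auto simp: pexp_gauge_mono pexp_gauge_def[of s 0])
      also have "real ((m + 1) ^ N) * pexp_gauge s (3 * \<epsilon>) \<le> G \<epsilon>"
      proof -
        have "real ((m + 1) ^ N) = exp (real N * ln (real m + 1))"
          by (simp add: exp_of_nat_mult add.commute)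
        also have "\<dots> \<le> exp (\<epsilon> powr -t * ln (D powr p * \<epsilon> powr -(t + p) + 3))"
        proof -
          have "real N * ln (real m + 1) \<le> \<epsilon> powr -t * ln (D powr p * \<epsilon> powr -(t + p) + 3)"
            using N_le m_le by (intro mult_mono) auto
          then show ?thesis by simp
        qed
        finally have "real ((m + 1) ^ N) * pexp_gauge s (3 * \<epsilon>)
            \<le> exp (\<epsilon> powr -t * ln (D powr p * \<epsilon> powr -(t + p) + 3)) * pexp_gauge s (3 * \<epsilon>)"
          by (intro mult_right_mono) (auto simp: pexp_gauge_def)
        also have "\<dots> = G \<epsilon>" using \<epsilon> by (simp add: G_def pexp_gauge_def flip: exp_add)
        finally show ?thesis .
      qed
      finally show ?case by (simp add: ennreal_leI)
    qed
  qed simp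
  then have "gauge_measure (pexp_gauge s) (borel_probs :: 'a measure set) (wasserstein_dist p) \<le> 0"
    unfolding gauge_measure_eq_SUP by (intro SUP_least) auto
  then show False using pos by simp
qed

section \<open>Lower bounds for transport and for random codes\<close>

text \<open>The easy direction of Kantorovich duality: \<open>f\<close> is 1-Lipschitz, so along a
  coupling of cost below \<open>\<epsilon> powr p\<close> the integrals differ by at most the mean
  displacement, which that cost bounds by \<open>2 * \<epsilon>\<close>.\<close>

lemma nn_integral_le_of_wasserstein_less:
  fixes \<mu> \<nu> :: "'a::metric_space measure" and f :: "'a \<Rightarrow> real"
  assumes compact: "compact (UNIV :: 'a set)" and "1 \<le> p"
    and \<mu>: "\<mu> \<in> borel_probs" and \<nu>: "\<nu> \<in> borel_probs"
    and W: "wasserstein_dist p \<mu> \<nu> < \<epsilon>"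
    and meas: "f \<in> borel_measurable borel" and f: "\<And>x. 0 \<le> f x" "\<And>x y. f x \<le> f y + dist x y"
  shows "(\<integral>\<^sup>+ x. ennreal (f x) \<partial>\<mu>) \<le> (\<integral>\<^sup>+ x. ennreal (f x) \<partial>\<nu>) + ennreal (2 * \<epsilon>)"
proof -
  define I where "I = (INF \<gamma>\<in>couplings \<mu> \<nu>. \<integral>\<^sup>+ (x, y). ennreal (dist x y powr p) \<partial>\<gamma>)"
  obtain D where D: "1 \<le> D" "\<And>x y :: 'a. dist x y \<le> D"
    using compact_UNIV_dist_bound[OF compact] by blast
  \<comment> \<open>\<open>enn2real\<close> sends \<open>top\<close> to \<open>0\<close>, so a small
    distance is informative only once the infimum is known to be finite. A single cell, with
    discrepancy \<open>1\<close>, suffices for that.\<close>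
  have "I \<le> ennreal (D powr p + D powr p * (real 1 * 1))"
    unfolding I_def
  proof (rule transport_cost_le_of_close_masses[OF compact \<mu> \<nu>, of "\<lambda>_. 0"])
    interpret M: prob_space \<mu> using \<mu> by (simp add: borel_probs_def)
    interpret N: prob_space \<nu> using \<nu> by (simp add: borel_probs_def)
    show "\<bar>measure \<mu> ((\<lambda>_. 0) -` {i}) - measure \<nu> ((\<lambda>_. 0) -` {i})\<bar> \<le> 1" for i :: nat
      using M.prob_le_1[of "(\<lambda>_. 0) -` {i}"] N.prob_le_1[of "(\<lambda>_. 0) -` {i}"]
        measure_nonneg[of \<mu> "(\<lambda>_. 0) -` {i}"] measure_nonneg[of \<nu> "(\<lambda>_. 0) -` {i}"] by linarith
  qed (use D \<open>1 \<le> p\<close> in auto)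
  then have "I < top" by (rule le_less_trans) simp
  have "0 < \<epsilon>" using W by (rule le_less_trans[rotated]) (simp add: wasserstein_dist_def)
  have "enn2real I = (wasserstein_dist p \<mu> \<nu>) powr p"
    using \<open>1 \<le> p\<close> by (simp add: wasserstein_dist_def I_def powr_powr)
  also have "\<dots> < \<epsilon> powr p"
    using W \<open>1 \<le> p\<close> by (intro powr_less_mono2) (auto simp: wasserstein_dist_def)
  finally have "I < ennreal (\<epsilon> powr p)"
    using \<open>I < top\<close> by (cases I) (auto simp: ennreal_less_iff)
  then obtain \<gamma> where \<gamma>: "\<gamma> \<in> couplings \<mu> \<nu>"
    and cost: "(\<integral>\<^sup>+ (x, y). ennreal (dist x y powr p) \<partial>\<gamma>) < ennreal (\<epsilon> powr p)"
    unfolding I_def INF_less_iff by blast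
  have sets: "sets \<gamma> = sets borel" and "prob_space \<gamma>" and d1: "distr \<gamma> borel fst = \<mu>" and d2: "distr \<gamma> borel snd = \<nu>"
    using \<gamma> by (auto simp: couplings_def borel_probs_def)
  interpret G: prob_space \<gamma> by fact
  have fst_m: "fst \<in> measurable \<gamma> borel" and snd_m: "snd \<in> measurable \<gamma> borel"
    by (subst measurable_cong_sets[OF sets refl], intro borel_measurable_continuous_onI continuous_intros)+
  have dist_m [measurable]: "(\<lambda>z. dist (fst z) (snd z)) \<in> borel_measurable \<gamma>"
    by (subst measurable_cong_sets[OF sets refl]) (intro borel_measurable_continuous_onI continuous_intros)
  have fm: "(\<lambda>z. f (snd z)) \<in> borel_measurable \<gamma>"
    using measurable_compose[OF snd_m meas] .
  txt \<open>This elementary bound stands in for Jensen's inequality, at the cost of a factor 2.\<close>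
  have linear_le: "x \<le> \<epsilon> + x powr p / \<epsilon> powr (p - 1)" if "0 \<le> x" for x
  proof (cases "x \<le> \<epsilon>")
    case False
    have "x * 1 \<le> x * (x / \<epsilon>) powr (p - 1)"
      using False \<open>1 \<le> p\<close> \<open>0 < \<epsilon>\<close> by (intro mult_left_mono ge_one_powr_ge_zero) auto
    also have "\<dots> = x powr p / \<epsilon> powr (p - 1)"
      using False \<open>0 < \<epsilon>\<close> by (simp add: powr_divide powr_diff)
    finally show ?thesis using \<open>0 < \<epsilon>\<close> by simp
  qed (simp add: add_increasing2)
  have "(\<integral>\<^sup>+ x. ennreal (f x) \<partial>\<mu>) = (\<integral>\<^sup>+ z. ennreal (f (fst z)) \<partial>\<gamma>)"
    unfolding d1[symmetric] using fst_m meas by (subst nn_integral_distr) auto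
  also have "\<dots> \<le> (\<integral>\<^sup>+ z. ennreal (f (snd z)) + (ennreal \<epsilon> + ennreal (1 / \<epsilon> powr (p - 1)) * ennreal (dist (fst z) (snd z) powr p)) \<partial>\<gamma>)"
  proof (rule nn_integral_mono)
    fix z
    have "f (fst z) \<le> f (snd z) + (\<epsilon> + 1 / \<epsilon> powr (p - 1) * dist (fst z) (snd z) powr p)"
      using f(2)[of "fst z" "snd z"] linear_le[of "dist (fst z) (snd z)"] by simp
    from ennreal_leI[OF this]
    show "ennreal (f (fst z)) \<le> ennreal (f (snd z)) + (ennreal \<epsilon> + ennreal (1 / \<epsilon> powr (p - 1)) * ennreal (dist (fst z) (snd z) powr p))"
      using f(1) \<open>0 < \<epsilon>\<close> by (simp flip: ennreal_plus ennreal_mult)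
  qed
  also have "\<dots> = (\<integral>\<^sup>+ z. ennreal (f (snd z)) \<partial>\<gamma>)
      + (ennreal \<epsilon> + ennreal (1 / \<epsilon> powr (p - 1)) * (\<integral>\<^sup>+ (x, y). ennreal (dist x y powr p) \<partial>\<gamma>))"
  proof -
    have "(\<integral>\<^sup>+ z. ennreal \<epsilon> + ennreal (1 / \<epsilon> powr (p - 1)) * ennreal (dist (fst z) (snd z) powr p) \<partial>\<gamma>)
        = ennreal \<epsilon> + ennreal (1 / \<epsilon> powr (p - 1)) * (\<integral>\<^sup>+ z. ennreal (dist (fst z) (snd z) powr p) \<partial>\<gamma>)"
      by (subst nn_integral_add) (simp_all add: nn_integral_cmult G.emeasure_space_1)
    then show ?thesis
      unfolding split_beta using fm by (subst nn_integral_add) auto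
  qed
  also have "(\<integral>\<^sup>+ z. ennreal (f (snd z)) \<partial>\<gamma>) = (\<integral>\<^sup>+ x. ennreal (f x) \<partial>\<nu>)"
    unfolding d2[symmetric] using snd_m meas by (subst nn_integral_distr) auto
  also have "ennreal \<epsilon> + ennreal (1 / \<epsilon> powr (p - 1)) * (\<integral>\<^sup>+ (x, y). ennreal (dist x y powr p) \<partial>\<gamma>)
      \<le> ennreal \<epsilon> + ennreal (1 / \<epsilon> powr (p - 1)) * ennreal (\<epsilon> powr p)"
    using cost by (intro add_left_mono mult_left_mono) auto
  also have "\<dots> = ennreal (2 * \<epsilon>)"
    using \<open>0 < \<epsilon>\<close> by (simp add: powr_diff flip: ennreal_mult ennreal_plus)
  finally show ?thesis by (simp add: add_left_mono)
qed

text \<open>A Chernoff-type count with \<open>n = card A\<close>. Translating by a member of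
  \<open>B\<close> leaves sets \<open>T\<close> of size at most \<open>n / 8\<close>, whose weights
  \<open>(1 / 4) ^ card T\<close> are at least \<open>(1 / 4) powr (n / 8)\<close>. All subsets
  together weigh \<open>(5 / 4) ^ n\<close>, and \<open>(5 / 6) ^ 8 \<le> 1 / 4\<close>, so at most
  \<open>(5 / 4) ^ n / (5 / 6) ^ n\<close> sets fit.\<close>

lemma hamming_ball_card_le:
  fixes B :: "'b set set"
  assumes "finite A" "B \<subseteq> Pow A"
    and close: "\<And>S T. S \<in> B \<Longrightarrow> T \<in> B \<Longrightarrow> 8 * card (sym_diff S T) \<le> card A"
  shows "real (card B) \<le> (3 / 2) ^ card A"
proof (cases "B = {}")
  case False
  then obtain S where S: "S \<in> B" by blast
  define n where "n = card A"
  define \<beta> :: real where "\<beta> = (1 / 4) powr (real n / 8)"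
  define Y where "Y = (\<lambda>T. sym_diff S T) ` B"
  have inj: "inj_on (\<lambda>T. sym_diff S T) B" by (rule inj_onI) blast
  have Y: "Y \<subseteq> Pow A" "finite Y"
    using S assms(1,2) by (auto simp: Y_def intro: finite_subset[of B "Pow A"])
  have "\<beta> \<le> (1 / 4) ^ card T" if "T \<in> Y" for T
  proof -
    have "8 * card T \<le> n" using that S close by (auto simp: Y_def n_def)
    then have "(1 / 4) powr (real n / 8) \<le> (1 / 4 :: real) powr (real (card T))"
      by (intro powr_mono') auto
    then show ?thesis by (simp add: \<beta>_def powr_realpow)
  qed
  then have "real (card Y) * \<beta> \<le> (\<Sum>T\<in>Y. (1 / 4) ^ card T)"
    using sum_bounded_below[of Y \<beta> "\<lambda>T. (1 / 4) ^ card T"] by simp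
  also have "\<dots> \<le> (\<Sum>T\<in>Pow A. (1 / 4) ^ card T)"
    using Y assms(1) by (intro sum_mono2) auto
  \<comment> \<open>The product of \<open>n\<close> factors \<open>1 / 4 + 1\<close>, expanded over
    subsets.\<close>
  also have "\<dots> = (5 / 4) ^ n"
    using prod_add[OF assms(1), of "\<lambda>_. 1 / 4 :: real" "\<lambda>_. 1"] by (simp add: n_def)
  finally have "real (card B) * \<beta> \<le> (5 / 4) ^ n"
    by (simp add: Y_def card_image[OF inj])
  moreover have "(5 / 6) ^ n \<le> \<beta>"
  proof -
    have "(5 / 6 :: real) powr 8 \<le> 1 / 4" by (simp add: power_divide)
    then have "((5 / 6 :: real) powr 8) powr (real n / 8) \<le> \<beta>"
      unfolding \<beta>_def by (intro powr_mono2) auto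
    then show ?thesis by (simp add: powr_powr powr_realpow del: powr_numeral)
  qed
  ultimately have "real (card B) * (5 / 6) ^ n \<le> (5 / 4) ^ n"
    by (meson mult_left_mono of_nat_0_le_iff order_trans)
  then have "real (card B) \<le> (5 / 4) ^ n / (5 / 6) ^ n" by (simp add: field_simps)
  also have "\<dots> = (3 / 2) ^ n" by (simp flip: power_divide)
  finally show ?thesis by (simp add: n_def)
qed simp

text \<open>\<open>F\<close> may fail to be measurable, so it is enclosed in the union of the
  cylinders over its prefixes up to index \<open>k\<close>. A prefix below \<open>k\<close> extends
  in at most \<open>b\<close> ways and all cylinders have equal probability, so at most a proportion
  \<open>b / card (A k)\<close> of them occurs.\<close>

lemma cylinder_hull:
  fixes A :: "nat \<Rightarrow> 'b set" and F :: "(nat \<Rightarrow> 'b) set"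
  assumes A: "\<And>j. finite (A j)" "\<And>j. A j \<noteq> {}"
    and F: "F \<subseteq> (\<Pi>\<^sub>E j\<in>UNIV. A j)"
    and b: "\<And>\<omega>. \<omega> \<in> F \<Longrightarrow> real (card {\<omega>' k | \<omega>'. \<omega>' \<in> F \<and> (\<forall>j<k. \<omega>' j = \<omega> j)}) \<le> b"
    and "0 \<le> b"
  shows "\<exists>G\<in>sets (\<Pi>\<^sub>M j\<in>UNIV. uniform_count_measure (A j)). F \<subseteq> G \<and>
    emeasure (\<Pi>\<^sub>M j\<in>UNIV. uniform_count_measure (A j)) G \<le> ennreal (b / real (card (A k)))"
proof -
  define P where "P = (\<Pi>\<^sub>M j\<in>UNIV. uniform_count_measure (A j))"
  interpret product_prob_space "\<lambda>j. uniform_count_measure (A j)" UNIV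
    using A by (intro product_prob_spaceI prob_space_uniform_count_measure) auto
  have space: "space P = (\<Pi>\<^sub>E j\<in>UNIV. A j)"
    by (simp add: P_def space_PiM space_uniform_count_measure)
  define R where "R = (\<lambda>\<omega>. restrict \<omega> {..k}) ` F"
  have R_sub: "R \<subseteq> (\<Pi>\<^sub>E j\<in>{..k}. A j)" using F by (auto simp: R_def PiE_def Pi_def)
  then have "finite R" by (rule finite_subset) (auto intro: finite_PiE A)
  define cyl where "cyl \<tau> = {\<omega>\<in>space P. \<forall>j\<in>{..k}. \<omega> j \<in> {\<tau> j}}" for \<tau>
  have single: "{\<tau> j} \<in> sets (uniform_count_measure (A j))" if "\<tau> \<in> R" "j \<le> k" for \<tau> j
    using R_sub that by (auto simp: sets_uniform_count_measure PiE_def Pi_def)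
  have cyl_sets: "cyl \<tau> \<in> sets P" if "\<tau> \<in> R" for \<tau>
  proof -
    have "cyl \<tau> = (\<Inter>j\<in>{..k}. (\<lambda>\<omega>. \<omega> j) -` {\<tau> j} \<inter> space P)" by (auto simp: cyl_def)
    also have "\<dots> \<in> sets P"
      unfolding P_def
      by (intro sets.finite_INT measurable_sets[OF measurable_component_singleton] single[OF that]) auto
    finally show ?thesis .
  qed
  have cyl_prob: "emeasure P (cyl \<tau>) = ennreal (1 / (\<Prod>j\<le>k. real (card (A j))))" if "\<tau> \<in> R" for \<tau>
  proof -
    have "emeasure P (cyl \<tau>) = (\<Prod>j\<in>{..k}. emeasure (uniform_count_measure (A j)) {\<tau> j})"
      unfolding cyl_def P_def using single[OF that] by (intro emeasure_PiM_Collect) auto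
    also have "\<dots> = (\<Prod>j\<in>{..k}. ennreal (1 / real (card (A j))))"
      using R_sub that A by (intro prod.cong refl, subst emeasure_uniform_count_measure) (auto simp: PiE_def Pi_def)
    also have "\<dots> = ennreal (1 / (\<Prod>j\<le>k. real (card (A j))))"
      by (subst prod_ennreal) (auto simp: prod_dividef)
    finally show ?thesis .
  qed
  define G where "G = (\<Union>\<tau>\<in>R. cyl \<tau>)"
  have G_sets: "G \<in> sets P" unfolding G_def using \<open>finite R\<close> cyl_sets by (intro sets.finite_UN) auto
  have "F \<subseteq> G"
  proof
    fix \<omega> assume "\<omega> \<in> F"
    then have "restrict \<omega> {..k} \<in> R" "\<omega> \<in> cyl (restrict \<omega> {..k})" using F by (auto simp: R_def cyl_def space)
    then show "\<omega> \<in> G" unfolding G_def by blast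
  qed
  \<comment> \<open>\<open>R\<close> consists of prefixes on \<open>{..k}\<close>, \<open>R'\<close>
    of prefixes on \<open>{..<k}\<close>. Bounding the fibres of \<open>R\<close> over
    \<open>R'\<close> by \<open>b\<close> is where the hypothesis on extensions enters.\<close>
  define R' where "R' = (\<lambda>\<tau>. restrict \<tau> {..<k}) ` R"
  have R'_sub: "R' \<subseteq> (\<Pi>\<^sub>E j\<in>{..<k}. A j)" using R_sub by (auto simp: R'_def PiE_def Pi_def)
  have "real (card R) \<le> (\<Prod>j<k. real (card (A j))) * b"
  proof -
    define fib where "fib \<sigma> = {\<tau>\<in>R. restrict \<tau> {..<k} = \<sigma>}" for \<sigma>
    have fib: "real (card (fib \<sigma>)) \<le> b" if \<sigma>: "\<sigma> \<in> R'" for \<sigma>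
    proof -
      obtain \<omega> where \<omega>: "\<omega> \<in> F" "\<sigma> = restrict (restrict \<omega> {..k}) {..<k}"
        using \<sigma> by (auto simp: R'_def R_def)
      define H where "H = {\<omega>' k | \<omega>'. \<omega>' \<in> F \<and> (\<forall>j<k. \<omega>' j = \<omega> j)}"
      have "H \<subseteq> A k" using F by (auto simp: H_def PiE_def Pi_def)
      then have "finite H" using A finite_subset by blast
      have agree: "\<tau> j = \<omega> j" if "\<tau> \<in> fib \<sigma>" "j < k" for \<tau> j
      proof -
        have "restrict \<tau> {..<k} = \<sigma>" using that(1) by (simp add: fib_def)
        then have "restrict \<tau> {..<k} j = \<sigma> j" by simp
        then show ?thesis using that(2) by (simp add: \<omega>(2))
      qed
      have "card (fib \<sigma>) \<le> card H"
      proof (rule card_inj_on_le)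
        show "inj_on (\<lambda>\<tau>. \<tau> k) (fib \<sigma>)"
        proof (rule inj_onI)
          fix \<tau> \<tau>' assume *: "\<tau> \<in> fib \<sigma>" "\<tau>' \<in> fib \<sigma>" "\<tau> k = \<tau>' k"
          then have "\<tau> \<in> (\<Pi>\<^sub>E j\<in>{..k}. A j)" "\<tau>' \<in> (\<Pi>\<^sub>E j\<in>{..k}. A j)"
            using R_sub by (auto simp: fib_def)
          then show "\<tau> = \<tau>'"
          proof (rule PiE_ext)
            fix j assume "j \<in> {..k}"
            then show "\<tau> j = \<tau>' j" using *(3) agree[OF *(1), of j] agree[OF *(2), of j] by (cases "j = k") auto
          qed
        qed
        show "(\<lambda>\<tau>. \<tau> k) ` fib \<sigma> \<subseteq> H"
        proof
          fix v assume "v \<in> (\<lambda>\<tau>. \<tau> k) ` fib \<sigma>"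
          then obtain \<tau> where \<tau>: "\<tau> \<in> fib \<sigma>" "v = \<tau> k" by blast
          then obtain \<omega>' where \<omega>': "\<omega>' \<in> F" "\<tau> = restrict \<omega>' {..k}" by (auto simp: fib_def R_def)
          have "\<omega>' j = \<omega> j" if "j < k" for j using agree[OF \<tau>(1) that] that by (simp add: \<omega>'(2))
          then show "v \<in> H" using \<tau> \<omega>' by (auto simp: H_def)
        qed
      qed fact
      moreover have "real (card H) \<le> b" unfolding H_def by (rule b[OF \<omega>(1)])
      ultimately show ?thesis by linarith
    qed
    have "R = (\<Union>\<sigma>\<in>R'. fib \<sigma>)" by (auto simp: R'_def fib_def)
    moreover have "finite R'" using \<open>finite R\<close> by (simp add: R'_def)
    ultimately have "card R \<le> (\<Sum>\<sigma>\<in>R'. card (fib \<sigma>))" using card_UN_le by metis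
    then have "real (card R) \<le> (\<Sum>\<sigma>\<in>R'. real (card (fib \<sigma>)))" by (metis of_nat_mono of_nat_sum)
    also have "\<dots> \<le> real (card R') * b" using sum_mono[of R' "\<lambda>\<sigma>. real (card (fib \<sigma>))" "\<lambda>_. b", OF fib] by simp
    also have "card R' \<le> card (\<Pi>\<^sub>E j\<in>{..<k}. A j)"
      using R'_sub A by (intro card_mono finite_PiE) auto
    then have "real (card R') * b \<le> (\<Prod>j<k. real (card (A j))) * b"
      using \<open>0 \<le> b\<close> by (intro mult_right_mono) (simp_all add: card_PiE flip: of_nat_prod)
    finally show ?thesis .
  qed
  then have card_R: "real (card R) / (\<Prod>j\<le>k. real (card (A j))) \<le> b / real (card (A k))"
  proof -
    assume le: "real (card R) \<le> (\<Prod>j<k. real (card (A j))) * b"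
    have pos: "0 < real (card (A j))" for j using A[of j] by (simp add: card_gt_0_iff)
    have "(\<Prod>j\<le>k. real (card (A j))) = (\<Prod>j<k. real (card (A j))) * real (card (A k))"
      by (simp flip: lessThan_Suc_atMost)
    moreover have "0 < (\<Prod>j<k. real (card (A j)))" using pos by (intro prod_pos) auto
    ultimately show ?thesis using le pos[of k] by (simp add: field_simps)
  qed
  have "emeasure P G \<le> (\<Sum>\<tau>\<in>R. emeasure P (cyl \<tau>))"
    unfolding G_def using \<open>finite R\<close> cyl_sets by (intro emeasure_subadditive_finite) auto
  also have "\<dots> = ennreal (real (card R) / (\<Prod>j\<le>k. real (card (A j))))"
    using cyl_prob by (simp add: ennreal_of_nat_eq_real_of_nat prod_nonneg flip: ennreal_mult)
  also have "\<dots> \<le> ennreal (b / real (card (A k)))" using card_R by (rule ennreal_leI)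
  finally show ?thesis using G_sets \<open>F \<subseteq> G\<close> unfolding P_def by blast
qed

text \<open>
  The points \<open>x k 1, \<dots>, x k (N k)\<close> carry the code word \<open>\<omega> k\<close>: each of them gives its mass to
  \<open>x k 0\<close> unless its index belongs to \<open>\<omega> k\<close>. Level \<open>k\<close> has weight \<open>63 / 64 * (1 / 64) ^ k\<close>, so the
  levels above \<open>k\<close> together weigh too little to hide a change of \<open>\<omega> k\<close>.
\<close>

definition random_blend :: "(nat \<Rightarrow> nat \<Rightarrow> 'a) \<Rightarrow> (nat \<Rightarrow> nat) \<Rightarrow> (nat \<Rightarrow> nat set) \<Rightarrow> 'a pmf" where
  "random_blend x N \<omega> = bind_pmf (geometric_pmf (63 / 64))
     (\<lambda>k. map_pmf (\<lambda>i. if i \<in> \<omega> k then x k i else x k 0) (pmf_of_set {1..N k}))"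

definition blend_measure :: "(nat \<Rightarrow> nat \<Rightarrow> 'a::topological_space) \<Rightarrow> (nat \<Rightarrow> nat) \<Rightarrow> (nat \<Rightarrow> nat set) \<Rightarrow> 'a measure" where
  "blend_measure x N \<omega> = distr (measure_pmf (random_blend x N \<omega>)) borel id"

section \<open>Distances between coded measures\<close>

lemma blend_measure_in_borel_probs: "blend_measure x N \<omega> \<in> borel_probs"
  by (auto simp: blend_measure_def borel_probs_def intro!: prob_space.prob_space_distr prob_space_measure_pmf)

lemma nn_integral_blend_measure:
  assumes "f \<in> borel_measurable borel" and "\<And>k. 1 \<le> N k"
  shows "(\<integral>\<^sup>+ y. f y \<partial>blend_measure x N \<omega>)
    = (\<integral>\<^sup>+ k. (\<Sum>i=1..N k. f (if i \<in> \<omega> k then x k i else x k 0)) / real (N k) \<partial>geometric_pmf (63 / 64))"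
proof -
  have "{1..N k} \<noteq> {}" for k using assms(2)[of k] by simp
  then have "(\<integral>\<^sup>+ i. f (if i \<in> \<omega> k then x k i else x k 0) \<partial>pmf_of_set {1..N k})
      = (\<Sum>i=1..N k. f (if i \<in> \<omega> k then x k i else x k 0)) / real (N k)" for k
    by (subst nn_integral_pmf_of_set) (auto simp: ennreal_of_nat_eq_real_of_nat)
  then show ?thesis
    using assms(1) unfolding blend_measure_def random_blend_def
    by (subst nn_integral_distr) (auto simp: o_def)
qed

lemma emeasure_geometric_greaterThan:
  fixes p :: real
  assumes "0 < p" "p \<le> 1"
  shows "emeasure (geometric_pmf p) {k<..} = ennreal ((1 - p) ^ Suc k)"
proof -
  have "measure (geometric_pmf p) {..k} = (\<Sum>j\<le>k. (1 - p) ^ j * p)"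
    using assms by (subst measure_measure_pmf_finite) auto
  also have "\<dots> = 1 - (1 - p) ^ Suc k"
    using sum_gp_basic[of "1 - p" k] by (simp add: mult.commute flip: sum_distrib_left)
  finally have "measure (geometric_pmf p) (UNIV - {..k}) = (1 - p) ^ Suc k"
    using measure_pmf.prob_compl[of "{..k}" "geometric_pmf p"] by simp
  moreover have "UNIV - {..k} = {k<..}" by auto
  ultimately show ?thesis by (simp add: measure_pmf.emeasure_eq_measure)
qed

text \<open>The test function is a bump of height \<open>r\<close> around the points
  \<open>x k i\<close> with \<open>i \<in> \<omega> k - \<omega>' k\<close>. Levels below
  \<open>k\<close> contribute equally to both integrals, level \<open>k\<close> separates them, and
  the levels above have total weight \<open>(1 / 64) ^ Suc k\<close>. Duality gives
  \<open>c * 63 \<le> 3\<close> for the proportion \<open>c\<close> of such indices, which is below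
  \<open>1 / 16\<close>.\<close>

lemma card_diff_le_of_wasserstein_less:
  fixes x :: "nat \<Rightarrow> nat \<Rightarrow> 'a::metric_space"
  assumes compact: "compact (UNIV :: 'a set)" and "1 \<le> p"
    and N: "\<And>j. 1 \<le> N j" and "0 < r"
    and sep: "\<And>i j. i \<le> N k \<Longrightarrow> j \<le> N k \<Longrightarrow> i \<noteq> j \<Longrightarrow> r \<le> dist (x k i) (x k j)"
    and \<omega>: "\<omega> k \<subseteq> {1..N k}"
    and agree: "\<And>j. j < k \<Longrightarrow> \<omega> j = \<omega>' j"
    and W: "wasserstein_dist p (blend_measure x N \<omega>) (blend_measure x N \<omega>') < r / 64 ^ Suc k"
  shows "16 * card (\<omega> k - \<omega>' k) \<le> N k"
proof (cases "\<omega> k - \<omega>' k = {}")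
  case False
  define S where "S = x k ` (\<omega> k - \<omega>' k)"
  have "S \<noteq> {}" using False by (simp add: S_def)
  \<comment> \<open>\<open>f\<close> is 1-Lipschitz, and by separation it vanishes at the points of
    level \<open>k\<close> with any other index.\<close>
  define f where "f y = max 0 (r - infdist y S)" for y
  have f0: "0 \<le> f y" and fr: "f y \<le> r" for y using \<open>0 < r\<close> by (auto simp: f_def infdist_nonneg)
  have f_lip: "f y \<le> f z + dist y z" for y z
    using infdist_triangle[of z S y] by (auto simp: f_def dist_commute)
  have f_meas: "f \<in> borel_measurable borel"
    unfolding f_def by (intro borel_measurable_continuous_onI continuous_intros)
  have f_on: "f (x k i) = r" if "i \<in> \<omega> k - \<omega>' k" for i
    using that \<open>0 < r\<close> by (simp add: f_def S_def)
  have f_off: "f (x k i) = 0" if "i \<le> N k" "i \<notin> \<omega> k - \<omega>' k" for i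
  proof -
    have "r \<le> infdist (x k i) S"
      unfolding infdist_notempty[OF \<open>S \<noteq> {}\<close>]
    proof (rule cINF_greatest[OF \<open>S \<noteq> {}\<close>])
      fix s assume "s \<in> S"
      then obtain j where "j \<in> \<omega> k - \<omega>' k" "s = x k j" by (auto simp: S_def)
      then show "r \<le> dist (x k i) s" using that \<omega> by (auto intro!: sep)
    qed
    then show ?thesis by (simp add: f_def)
  qed
  \<comment> \<open>Index \<open>0\<close> lies outside \<open>\<omega> k\<close>, so the mass
    collected at \<open>x k 0\<close> is invisible to \<open>f\<close>.\<close>
  have "0 \<notin> \<omega> k" using \<omega> by auto
  then have f_zero: "f (x k 0) = 0" using f_off[of 0] by simp
  define a where "a v j = (\<Sum>i=1..N j. f (if i \<in> v j then x j i else x j 0)) / real (N j)" for v :: "nat \<Rightarrow> nat set" and j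
  define I where "I v = (\<integral>\<^sup>+ j. ennreal (a v j) \<partial>geometric_pmf (63 / 64))" for v
  have a0: "0 \<le> a v j" for v j unfolding a_def using f0 by (auto intro!: divide_nonneg_nonneg sum_nonneg)
  have ar: "a v j \<le> r" for v j
  proof -
    have "(\<Sum>i=1..N j. f (if i \<in> v j then x j i else x j 0)) \<le> (\<Sum>i=1..N j. r)"
      using fr by (intro sum_mono) auto
    then show ?thesis using N[of j] by (simp add: a_def field_simps)
  qed
  have int: "(\<integral>\<^sup>+ y. ennreal (f y) \<partial>blend_measure x N v) = I v" for v
  proof -
    have "(\<Sum>i=1..N j. ennreal (f (if i \<in> v j then x j i else x j 0))) / ennreal (real (N j)) = ennreal (a v j)" for j
      unfolding a_def using f0 N[of j] by (simp add: sum_nonneg divide_ennreal)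
    then show ?thesis
      unfolding I_def using f_meas N by (subst nn_integral_blend_measure) auto
  qed
  define c where "c = real (card (\<omega> k - \<omega>' k)) / real (N k)"
  have ak: "a \<omega> k = c * r"
  proof -
    have "(\<Sum>i=1..N k. f (if i \<in> \<omega> k then x k i else x k 0)) = (\<Sum>i=1..N k. if i \<in> \<omega> k - \<omega>' k then r else 0)"
      using f_on f_off f_zero \<omega> by (intro sum.cong refl) auto
    also have "\<dots> = real (card ({1..N k} \<inter> (\<omega> k - \<omega>' k))) * r"
      by (simp add: sum.If_cases Int_def)
    also have "{1..N k} \<inter> (\<omega> k - \<omega>' k) = \<omega> k - \<omega>' k" using \<omega> by auto
    finally show ?thesis by (simp add: a_def c_def)
  qed
  have ak': "a \<omega>' k = 0"
    unfolding a_def using f_off f_zero by (auto intro!: sum.neutral)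
  \<comment> \<open>Both sides are sums because subtraction in \<open>ennreal\<close> is truncated.
    For \<open>j > k\<close> the comparison rests on \<open>a \<omega>' j \<le> r\<close>.\<close>
  have "I \<omega>' + ennreal (c * r) * emeasure (geometric_pmf (63 / 64)) {k}
      = (\<integral>\<^sup>+ j. ennreal (a \<omega>' j) + ennreal (c * r) * indicator {k} j \<partial>geometric_pmf (63 / 64))"
    by (simp add: I_def nn_integral_add nn_integral_cmult)
  also have "\<dots> \<le> (\<integral>\<^sup>+ j. ennreal (a \<omega> j) + ennreal r * indicator {k<..} j \<partial>geometric_pmf (63 / 64))"
  proof (rule nn_integral_mono)
    fix j
    consider "j < k" | "j = k" | "k < j" by linarith
    then show "ennreal (a \<omega>' j) + ennreal (c * r) * indicator {k} j \<le> ennreal (a \<omega> j) + ennreal r * indicator {k<..} j"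
    proof cases
      case 1
      then show ?thesis using agree[OF 1] by (simp add: a_def)
    next
      case 2
      then show ?thesis by (simp add: ak ak')
    next
      case 3
      then show ?thesis using ar[of \<omega>' j] by (simp add: add_increasing ennreal_leI)
    qed
  qed
  also have "\<dots> = I \<omega> + ennreal r * emeasure (geometric_pmf (63 / 64)) {k<..}"
    by (simp add: I_def nn_integral_add nn_integral_cmult)
  also have "I \<omega> \<le> I \<omega>' + ennreal (2 * (r / 64 ^ Suc k))"
    unfolding int[symmetric]
    by (rule nn_integral_le_of_wasserstein_less[OF compact \<open>1 \<le> p\<close> _ _ W f_meas f0 f_lip])
      (rule blend_measure_in_borel_probs)+
  finally have "I \<omega>' + ennreal (c * r) * emeasure (geometric_pmf (63 / 64)) {k}
      \<le> I \<omega>' + (ennreal (2 * (r / 64 ^ Suc k)) + ennreal r * emeasure (geometric_pmf (63 / 64)) {k<..})"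
    by (simp add: add_right_mono add.assoc)
  \<comment> \<open>Finiteness permits cancelling \<open>I \<omega>'\<close>.\<close>
  moreover have "I \<omega>' < top"
  proof -
    have "I \<omega>' \<le> (\<integral>\<^sup>+ j. ennreal r \<partial>geometric_pmf (63 / 64))"
      unfolding I_def using ar by (intro nn_integral_mono ennreal_leI)
    then show ?thesis by (rule le_less_trans) simp
  qed
  ultimately have "ennreal (c * r) * emeasure (geometric_pmf (63 / 64)) {k}
      \<le> ennreal (2 * (r / 64 ^ Suc k)) + ennreal r * emeasure (geometric_pmf (63 / 64)) {k<..}"
    using ennreal_add_left_cancel_le by auto
  also have "emeasure (geometric_pmf (63 / 64)) {k<..} = ennreal ((1 / 64) ^ Suc k)"
    using emeasure_geometric_greaterThan[of "63 / 64" k] by simp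
  also have "emeasure (geometric_pmf (63 / 64)) {k} = ennreal ((1 / 64) ^ k * (63 / 64))"
    by (simp add: emeasure_pmf_single)
  finally have "ennreal (c * r * ((1 / 64) ^ k * (63 / 64))) \<le> ennreal (2 * (r / 64 ^ Suc k) + r * (1 / 64) ^ Suc k)"
    using \<open>0 < r\<close> by (simp add: c_def flip: ennreal_mult ennreal_plus)
  then have "c * r * ((1 / 64) ^ k * (63 / 64)) \<le> 2 * (r / 64 ^ Suc k) + r * (1 / 64) ^ Suc k"
    using \<open>0 < r\<close> by (subst (asm) ennreal_le_iff) auto
  then have "c * 63 \<le> 3" using \<open>0 < r\<close> by (simp add: field_simps power_divide)
  then have "real (16 * card (\<omega> k - \<omega>' k)) \<le> real (N k)"
    using N[of k] by (simp add: c_def field_simps)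
  then show ?thesis by linarith
next
  case True
  then show ?thesis by (simp only: card.empty)
qed

section \<open>Separated sets and the lower bound\<close>

text \<open>In base 2 the exponents are \<open>t * (k^2 + 8 * k + 13)\<close> on the left and
  \<open>t' * k^2\<close> on the right, so the gain \<open>(t' - t) * k^2\<close> absorbs the linear
  term and the constants. The factor \<open>ln (4 / 3)\<close> comes from
  \<open>(3 / 4) ^ n = exp (- n * ln (4 / 3))\<close>.\<close>

lemma code_rate:
  fixes t t' :: real
  assumes "0 < t" "t < t'"
  shows "\<forall>\<^sub>F k in sequentially. 1 / ((1 / 2) ^ (k + 1)\<^sup>2 / 64 ^ (k + 2)) powr t \<le> ln (4 / 3) * ((1 / 2) ^ k\<^sup>2) powr -t'"
proof -
  have half: "(1 / 2 :: real) ^ n = exp (- (ln 2 * real n))" for n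
    by (simp add: exp_minus exp_of_nat2_mult power_divide inverse_eq_divide)
  have exp_neg_powr: "1 / exp (- y) powr s = exp (s * y)" for y s :: real
  proof -
    have "exp (- y) powr s = exp (- (s * y))" unfolding powr_def by simp
    then show ?thesis by (simp add: exp_minus inverse_eq_divide)
  qed
  have left: "1 / ((1 / 2) ^ (k + 1)\<^sup>2 / 64 ^ (k + 2)) powr t = exp (t * (ln 2 * ((real k)\<^sup>2 + 8 * real k + 13)))" for k
  proof -
    have "(1 / 2) ^ (k + 1)\<^sup>2 / (64 :: real) ^ (k + 2) = (1 / 2) ^ ((k + 1)\<^sup>2 + 6 * (k + 2))"
      unfolding power_add power_mult by (simp add: power_divide)
    also have "\<dots> = exp (- (ln 2 * ((real k)\<^sup>2 + 8 * real k + 13)))"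
      unfolding half by (simp add: power2_eq_square algebra_simps)
    finally show ?thesis by (simp only: exp_neg_powr)
  qed
  have right: "((1 / 2) ^ k\<^sup>2) powr -t' = exp (t' * (ln 2 * (real k)\<^sup>2))" for k
    unfolding half powr_minus inverse_eq_divide of_nat_power by (rule exp_neg_powr)
  define a where "a = (t' - t) * ln 2"
  have "0 < a" using assms by (simp add: a_def)
  then have "((\<lambda>k. exp (t * ln 2 * (8 * real k + 13) - a * (real k)\<^sup>2)) \<longlongrightarrow> 0) sequentially"
    by real_asymp
  then have "\<forall>\<^sub>F k in sequentially. exp (t * ln 2 * (8 * real k + 13) - a * (real k)\<^sup>2) < ln (4 / 3)"
    by (rule order_tendstoD) simp
  then show ?thesis
  proof eventually_elim
    case (elim k)
    have "exp (t * (ln 2 * ((real k)\<^sup>2 + 8 * real k + 13)))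
        = exp (t * ln 2 * (8 * real k + 13) - a * (real k)\<^sup>2) * exp (t' * (ln 2 * (real k)\<^sup>2))"
      unfolding a_def by (simp add: algebra_simps flip: exp_add)
    also have "\<dots> \<le> ln (4 / 3) * exp (t' * (ln 2 * (real k)\<^sup>2))"
      using elim by (intro mult_right_mono) auto
    finally show ?case unfolding left right .
  qed
qed

text \<open>Covering sets of diameter \<open>0\<close> are later treated as sets of tiny positive
  diameter, at an error as small as desired.\<close>

lemma pexp_gauge_small:
  assumes "0 < s" "0 < e" "0 < \<delta>"
  obtains r where "0 < r" "r < \<delta>" "pexp_gauge s r \<le> e"
proof -
  have "((\<lambda>r. exp (- (1 / r powr s))) \<longlongrightarrow> 0) (at_right 0)"
    using \<open>0 < s\<close> by real_asymp
  then have "\<forall>\<^sub>F r in at_right 0. exp (- (1 / r powr s)) < e"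
    using \<open>0 < e\<close> by (rule order_tendstoD)
  moreover have "\<forall>\<^sub>F r in at_right (0::real). 0 < r \<and> r < \<delta>"
    using \<open>0 < \<delta>\<close> by (auto simp: eventually_at_right intro!: exI[of _ \<delta>])
  ultimately have "\<forall>\<^sub>F r in at_right 0. 0 < r \<and> r < \<delta> \<and> pexp_gauge s r \<le> e"
    by eventually_elim (simp add: pexp_gauge_def)
  then show ?thesis
    using eventually_happens[of _ "at_right (0::real)"] that by auto
qed

text \<open>Balls of radius \<open>r\<close> about a maximal \<open>r\<close>-separated set cover
  the space. With fewer than \<open>r powr -t + 1\<close> points, such covers would have content
  tending to \<open>0\<close> for some exponent \<open>s > t\<close> of positive measure. The
  summand \<open>1\<close> pays for the base point of index \<open>0\<close> in the codes.\<close>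

lemma separated_set_of_hausdorff_dim:
  assumes "0 < t" "ennreal t < hausdorff_dim (UNIV :: 'a::metric_space set) dist"
  shows "\<forall>\<^sub>F r in at_right 0. \<exists>S :: 'a set. finite S \<and> pairwise (\<lambda>x y. r \<le> dist x y) S \<and> r powr -t + 1 \<le> real (card S)"
proof -
  obtain s where s: "t < s" "0 < gauge_measure (\<lambda>r. r powr s) (UNIV :: 'a set) dist"
    using assms by (auto simp: hausdorff_dim_def critical_parameter_def less_SUP_iff ennreal_less_iff)
  then obtain \<delta> where \<delta>: "0 < \<delta>" "0 < cover_content (\<lambda>r. r powr s) (UNIV :: 'a set) dist \<delta>"
    by (auto simp: gauge_measure_eq_SUP less_SUP_iff)
  obtain c' where c': "0 < c'" "c' < cover_content (\<lambda>r. r powr s) (UNIV :: 'a set) dist \<delta>"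
    using dense[OF \<delta>(2)] by blast
  then obtain c where c: "0 < c" "ennreal c \<le> cover_content (\<lambda>r. r powr s) (UNIV :: 'a set) dist \<delta>"
    by (cases c') auto
  have "\<forall>\<^sub>F r in at_right 0. (r powr -t + 2) * (2 * r) powr s < c"
  proof (rule order_tendstoD(2))
    show "((\<lambda>r. (r powr -t + 2) * (2 * r) powr s) \<longlongrightarrow> 0) (at_right 0)"
      using assms(1) s(1) by real_asymp
  qed fact
  moreover have "\<forall>\<^sub>F r in at_right (0::real). 0 < r \<and> 2 * r < \<delta>"
    using \<open>0 < \<delta>\<close> by (auto simp: eventually_at_right intro!: exI[of _ "\<delta> / 2"])
  ultimately show ?thesis
  proof eventually_elim
    case (elim r)
    define Q where "Q S \<longleftrightarrow> finite S \<and> pairwise (\<lambda>x y. r \<le> dist x y) S" for S :: "'a set"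
    show ?case
    proof (rule ccontr)
      assume neg: "\<not> ?thesis"
      \<comment> \<open>A uniform bound on cardinalities ensures that a separated set of maximal
        cardinality exists.\<close>
      have bound: "card S \<le> nat \<lceil>r powr -t + 1\<rceil>" if "Q S" for S
      proof -
        have "real (card S) < r powr -t + 1" using neg that by (force simp: Q_def)
        then show ?thesis by linarith
      qed
      have "Q {}" by (simp add: Q_def)
      moreover have "\<forall>S. Q S \<longrightarrow> card S < Suc (nat \<lceil>r powr -t + 1\<rceil>)"
        using bound le_imp_less_Suc by blast
      ultimately obtain S where S: "Q S" and max: "\<And>T. Q T \<Longrightarrow> card T \<le> card S"
        using ex_has_greatest_nat[of Q "{}" card] by blast
      obtain h where h: "bij_betw h {..<card S} S"
        using ex_bij_betw_nat_finite[of S] S by (auto simp: Q_def atLeast0LessThan)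
      have "\<exists>s\<in>S. dist s x < r" for x
      proof (rule ccontr)
        assume far: "\<not> ?thesis"
        then have "x \<notin> S" using elim by auto
        have "Q (insert x S)"
          using S far by (auto simp: Q_def pairwise_insert not_less dist_commute)
        from max[OF this] show False using \<open>x \<notin> S\<close> S by (simp add: Q_def)
      qed
      then have "(\<Union>y\<in>h ` {..<card S}. ball y r) = UNIV"
        using h by (auto simp: bij_betw_def)
      then have cover: "(\<Union>i<card S. ball (h i) r) = UNIV" by (simp only: image_image)
      have "cover_content (\<lambda>r. r powr s) (UNIV :: 'a set) dist \<delta> \<le> ennreal (real (card S) * (2 * r) powr s)"
      proof (rule cover_content_le[OF cover])
        show "dist x y \<le> 2 * r" if "x \<in> ball (h i) r" "y \<in> ball (h i) r" for i x y
          using that dist_triangle[of x y "h i"] by (auto simp: dist_commute)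
      qed (use elim assms(1) s(1) in \<open>auto intro!: powr_mono2\<close>)
      with c(2) have "ennreal c \<le> ennreal (real (card S) * (2 * r) powr s)" by (rule order_trans)
      then have "c \<le> real (card S) * (2 * r) powr s" by (subst (asm) ennreal_le_iff) auto
      moreover have "real (card S) < r powr -t + 1" using neg S by (force simp: Q_def)
      then have "real (card S) * (2 * r) powr s \<le> (r powr -t + 2) * (2 * r) powr s"
        by (intro mult_right_mono) auto
      ultimately show False using elim by linarith
    qed
  qed
qed

text \<open>Mass distribution principle for random code words with law \<open>P\<close>.
  Measurability of the map from words to measures is avoided: the preimage of each covering set is
  enclosed in a measurable set whose probability is compared with the gauge.\<close>

lemma gauge_measure_pexp_wasserstein_pos:
  fixes p t t' :: real
  assumes compact: "compact (UNIV :: 'a::metric_space set)" and "1 \<le> p" and "0 < t" "t < t'"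
    and sep: "\<forall>\<^sub>F r in at_right 0. \<exists>S :: 'a set. finite S \<and> pairwise (\<lambda>x y. r \<le> dist x y) S \<and> r powr -t' + 1 \<le> real (card S)"
  shows "0 < gauge_measure (pexp_gauge t) (borel_probs :: 'a measure set) (wasserstein_dist p)"
proof -
  txt \<open>
    The radii decrease fast enough for the weights \<open>64 ^ - k\<close> to be negligible powers of them, yet
    slowly enough that \<open>ln (r (k + 1)) / ln (r k)\<close> tends to 1.
  \<close>
  define r :: "nat \<Rightarrow> real" where "r k = (1 / 2) ^ k\<^sup>2" for k
  define \<rho> where "\<rho> k = r k / 64 ^ Suc k" for k
  have r0: "0 < r k" for k by (simp add: r_def)
  have \<rho>0: "0 < \<rho> k" for k using r0 by (simp add: \<rho>_def)
  \<comment> \<open>There are \<open>n + 1\<close> points: index \<open>0\<close> is the base, the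
    other \<open>n\<close> carry the code.\<close>
  define good where "good k x n \<longleftrightarrow> r k powr -t' \<le> real n \<and>
    (\<forall>i\<le>n. \<forall>j\<le>n. i \<noteq> j \<longrightarrow> r k \<le> dist (x i) (x j))" for k n and x :: "nat \<Rightarrow> 'a"
  have "filterlim r (at_right 0) sequentially"
    unfolding r_def by real_asymp
  from eventually_compose_filterlim[OF sep this]
  have "\<forall>\<^sub>F k in sequentially. \<exists>x n. 1 \<le> n \<and> good k x n"
  proof eventually_elim
    case (elim k)
    then obtain S :: "'a set" where S: "finite S" "pairwise (\<lambda>x y. r k \<le> dist x y) S" "r k powr -t' + 1 \<le> real (card S)"
      by blast
    have pos: "0 < r k powr -t'" using r0[of k] by simp
    obtain h where h: "bij_betw h {..<card S} S"
      using ex_bij_betw_nat_finite[OF S(1)] by (auto simp: atLeast0LessThan)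
    have card: "2 \<le> card S"
    proof -
      have "1 < real (card S)" using S(3) pos by linarith
      then show ?thesis by linarith
    qed
    have "good k h (card S - 1)"
      unfolding good_def
    proof (intro conjI allI impI)
      show "r k powr -t' \<le> real (card S - 1)" using S(3) card by (simp add: of_nat_diff)
      fix i j assume "i \<le> card S - 1" "j \<le> card S - 1" "i \<noteq> j"
      then have "i < card S" "j < card S" using card by auto
      then have "h i \<in> S" "h j \<in> S" "h i \<noteq> h j" using h \<open>i \<noteq> j\<close> by (auto simp: bij_betw_def inj_on_def)
      then show "r k \<le> dist (h i) (h j)" using S(2) by (auto simp: pairwise_def)
    qed
    then show ?case using card by (intro exI[of _ h] exI[of _ "card S - 1"]) auto
  qed
  moreover have "\<forall>\<^sub>F k in sequentially. 1 / \<rho> (k + 1) powr t \<le> ln (4 / 3) * r k powr -t'"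
    using code_rate[OF \<open>0 < t\<close> \<open>t < t'\<close>] by (simp add: \<rho>_def r_def)
  ultimately have "\<forall>\<^sub>F k in sequentially. (\<exists>x n. 1 \<le> n \<and> good k x n) \<and> 1 / \<rho> (k + 1) powr t \<le> ln (4 / 3) * r k powr -t'"
    by (rule eventually_conj)
  then obtain K where K: "\<And>k. K \<le> k \<Longrightarrow> \<exists>x n. 1 \<le> n \<and> good k x n"
    "\<And>k. K \<le> k \<Longrightarrow> 1 / \<rho> (k + 1) powr t \<le> ln (4 / 3) * r k powr -t'"
    unfolding eventually_sequentially by blast
  \<comment> \<open>Below \<open>K\<close> the points are arbitrary and \<open>N k\<close> is merely
    positive; these levels never serve to distinguish measures.\<close>
  have "\<exists>x n. 1 \<le> n \<and> (K \<le> k \<longrightarrow> good k x n)" for k using K(1)[of k] by (cases "K \<le> k") auto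
  then obtain x :: "nat \<Rightarrow> nat \<Rightarrow> 'a" and N where N: "\<And>k. 1 \<le> N k" and good: "\<And>k. K \<le> k \<Longrightarrow> good k (x k) (N k)"
    by metis
  define A where "A k = Pow {1..N k}" for k
  have A: "finite (A k)" "A k \<noteq> {}" "card (A k) = 2 ^ N k" for k by (auto simp: A_def card_Pow)
  define P where "P = (\<Pi>\<^sub>M k\<in>UNIV. uniform_count_measure (A k))"
  interpret P: prob_space P
    unfolding P_def using A by (intro prob_space_PiM prob_space_uniform_count_measure) auto
  have space_P: "space P = (\<Pi>\<^sub>E k\<in>UNIV. A k)"
    by (simp add: P_def space_PiM space_uniform_count_measure)
  define \<mu> where "\<mu> = blend_measure x N"
  define pre where "pre E = {\<omega>\<in>space P. \<mu> \<omega> \<in> E}" for E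
  have rate: "(3 / 4) ^ N k \<le> pexp_gauge t (\<rho> (Suc k))" if "K \<le> k" for k
  proof -
    have "1 / \<rho> (Suc k) powr t \<le> ln (4 / 3) * real (N k)"
      using K(2)[OF that] good[OF that] by (auto simp: good_def intro: order_trans mult_left_mono)
    then have "exp (- (ln (4 / 3) * real (N k))) \<le> pexp_gauge t (\<rho> (Suc k))"
      using \<rho>0 by (simp add: pexp_gauge_def)
    also have "exp (- (ln (4 / 3) * real (N k))) = (3 / 4) ^ N k"
      by (simp add: exp_minus exp_of_nat2_mult power_divide)
    finally show ?thesis .
  qed
  \<comment> \<open>Once the words below level \<open>k\<close> are fixed, those at level
    \<open>k\<close> are mutually close in Hamming distance, hence at most
    \<open>(3 / 2) ^ N k\<close> among \<open>2 ^ N k\<close> subsets.\<close>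
  have hull_level: "\<exists>G\<in>sets P. pre E \<subseteq> G \<and> emeasure P G \<le> ennreal ((3 / 4) ^ N k)"
    if "K \<le> k" and E: "\<And>\<mu> \<nu>. \<mu> \<in> E \<Longrightarrow> \<nu> \<in> E \<Longrightarrow> wasserstein_dist p \<mu> \<nu> < \<rho> k" for k E
  proof -
    have "\<exists>G\<in>sets P. pre E \<subseteq> G \<and> emeasure P G \<le> ennreal ((3 / 2) ^ N k / real (card (A k)))"
      unfolding P_def
    proof (rule cylinder_hull[OF A(1,2)])
      show "pre E \<subseteq> (\<Pi>\<^sub>E k\<in>UNIV. A k)" by (auto simp: pre_def space_P)
      fix \<omega> assume "\<omega> \<in> pre E"
      define B where "B = {\<omega>' k | \<omega>'. \<omega>' \<in> pre E \<and> (\<forall>j<k. \<omega>' j = \<omega> j)}"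
      have "real (card B) \<le> (3 / 2) ^ card {1..N k}"
      proof (rule hamming_ball_card_le)
        show "B \<subseteq> Pow {1..N k}" by (auto simp: B_def pre_def space_P A_def PiE_def Pi_def)
        have far: "16 * card (\<omega>1 k - \<omega>2 k) \<le> N k"
          if "\<omega>1 \<in> pre E" "\<omega>2 \<in> pre E" "\<And>j. j < k \<Longrightarrow> \<omega>1 j = \<omega>2 j" for \<omega>1 \<omega>2
        proof (rule card_diff_le_of_wasserstein_less[OF compact \<open>1 \<le> p\<close> N r0])
          show "r k \<le> dist (x k i) (x k j)" if "i \<le> N k" "j \<le> N k" "i \<noteq> j" for i j
            using good[OF \<open>K \<le> k\<close>] that by (simp add: good_def)
          show "\<omega>1 k \<subseteq> {1..N k}" using that(1) by (auto simp: pre_def space_P A_def PiE_def Pi_def)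
          show "wasserstein_dist p (blend_measure x N \<omega>1) (blend_measure x N \<omega>2) < r k / 64 ^ Suc k"
            using E[of "\<mu> \<omega>1" "\<mu> \<omega>2"] that by (auto simp: pre_def \<mu>_def \<rho>_def)
        qed (use that in auto)
        fix S T assume "S \<in> B" "T \<in> B"
        then obtain \<omega>1 \<omega>2 where "S = \<omega>1 k" "T = \<omega>2 k" "\<omega>1 \<in> pre E" "\<omega>2 \<in> pre E"
          "\<And>j. j < k \<Longrightarrow> \<omega>1 j = \<omega>2 j" by (auto simp: B_def)
        \<comment> \<open>The two one-sided bounds \<open>N k / 16\<close> add up to
          \<open>N k / 8\<close>.\<close>
        then have "16 * card (S - T) \<le> N k" "16 * card (T - S) \<le> N k"
          using far[of \<omega>1 \<omega>2] far[of \<omega>2 \<omega>1] by auto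
        then show "8 * card (sym_diff S T) \<le> card {1..N k}"
          using card_Un_le[of "S - T" "T - S"] by simp
      qed simp
      then show "real (card {\<omega>' k | \<omega>'. \<omega>' \<in> pre E \<and> (\<forall>j<k. \<omega>' j = \<omega> j)}) \<le> (3 / 2) ^ N k"
        by (simp add: B_def)
    qed simp
    moreover have "(3 / 2) ^ N k / real (card (A k)) = (3 / 4) ^ N k"
      by (simp add: A(3) flip: power_divide)
    ultimately show ?thesis by simp
  qed
  have \<rho>_lim: "\<rho> \<longlonglongrightarrow> 0"
    unfolding \<rho>_def r_def by real_asymp
  have hull: "\<exists>G\<in>sets P. pre E \<subseteq> G \<and> emeasure P G \<le> ennreal (pexp_gauge t D)"
    if D: "0 < D" "D < \<rho> K" and E: "\<And>\<mu> \<nu>. \<mu> \<in> E \<Longrightarrow> \<nu> \<in> E \<Longrightarrow> wasserstein_dist p \<mu> \<nu> \<le> D" for D E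
  proof -
    have "\<forall>\<^sub>F k in sequentially. \<rho> k < D" using \<rho>_lim D(1) by (rule order_tendstoD)
    then have ex: "\<exists>k\<ge>K. \<rho> k \<le> D"
      unfolding eventually_sequentially by (metis less_imp_le nat_le_linear)
    \<comment> \<open>Since \<open>D < \<rho> K\<close>, the least such level has a predecessor
      \<open>k \<ge> K\<close>, and \<open>\<rho> (Suc k) \<le> D < \<rho> k\<close>. The code of
      level \<open>k\<close> is thus compared with the gauge at the next radius, as in
      \<open>rate\<close>.\<close>
    define l where "l = (LEAST k. K \<le> k \<and> \<rho> k \<le> D)"
    have l: "K \<le> l" "\<rho> l \<le> D" using LeastI_ex[of "\<lambda>k. K \<le> k \<and> \<rho> k \<le> D"] ex by (auto simp: l_def)
    have "l \<noteq> K" using l D by auto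
    then obtain k where k: "l = Suc k" "K \<le> k" using l(1) by (cases l) auto
    have "D < \<rho> k"
      using not_less_Least[of k "\<lambda>k. K \<le> k \<and> \<rho> k \<le> D"] k by (auto simp: l_def[symmetric])
    then obtain G where "G \<in> sets P" "pre E \<subseteq> G" "emeasure P G \<le> ennreal ((3 / 4) ^ N k)"
      using hull_level[OF k(2), of E] E by (meson le_less_trans)
    moreover have "(3 / 4) ^ N k \<le> pexp_gauge t D"
      using rate[OF k(2)] pexp_gauge_mono[OF l(2) \<open>0 < t\<close>] by (simp add: k(1))
    ultimately show ?thesis by (meson ennreal_leI order_trans)
  qed
  \<comment> \<open>Half of \<open>\<rho> K\<close> keeps all diameters strictly below
    \<open>\<rho> K\<close>, as \<open>hull\<close> demands.\<close>
  have "ennreal (1 / 2) \<le> cover_content (pexp_gauge t) (borel_probs :: 'a measure set) (wasserstein_dist p) (\<rho> K / 2)"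
    unfolding cover_content_def
  proof (rule INF_greatest)
    fix E assume "E \<in> fine_covers (borel_probs :: 'a measure set) (wasserstein_dist p) (\<rho> K / 2)"
    then have UN: "(\<Union>i. E i) = borel_probs" and diam: "\<And>i. diam_on (wasserstein_dist p) (E i) \<le> ennreal (\<rho> K / 2)"
      by (auto simp: fine_covers_def)
    define D where "D i = enn2real (diam_on (wasserstein_dist p) (E i))" for i
    have dD: "diam_on (wasserstein_dist p) (E i) = ennreal (D i)" for i
      using le_less_trans[OF diam[of i] ennreal_less_top] by (simp add: D_def)
    have D0: "0 \<le> D i" for i by (simp add: D_def)
    have D_le: "D i \<le> \<rho> K / 2" for i
      using diam[of i] \<rho>0[of K] by (simp add: dD)
    have W: "wasserstein_dist p \<mu> \<nu> \<le> D i" if "\<mu> \<in> E i" "\<nu> \<in> E i" for \<mu> \<nu> i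
    proof -
      have "ennreal (wasserstein_dist p \<mu> \<nu>) \<le> diam_on (wasserstein_dist p) (E i)"
        unfolding diam_on_def using that by (intro SUP_upper2[of "(\<mu>, \<nu>)"]) auto
      then show ?thesis using D0[of i] by (simp add: dD)
    qed
    \<comment> \<open>The summands \<open>(1 / 2) ^ (i + 2)\<close> add up to \<open>1 / 2\<close>
      and pay for the sets of diameter \<open>0\<close>, whose gauge is \<open>0\<close>. The gauges
      must then supply the other half of the total probability.\<close>
    have "\<exists>G\<in>sets P. pre (E i) \<subseteq> G \<and> emeasure P G \<le> ennreal (pexp_gauge t (D i)) + ennreal ((1 / 2) ^ (i + 2))" for i
    proof (cases "0 < D i")
      case True
      moreover have "D i < \<rho> K" using D_le[of i] \<rho>0[of K] by simp
      ultimately obtain G where "G \<in> sets P" "pre (E i) \<subseteq> G" "emeasure P G \<le> ennreal (pexp_gauge t (D i))"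
        using hull[of "D i" "E i"] W by blast
      then show ?thesis by (auto intro!: bexI[of _ G] add_increasing2)
    next
      case False
      then have "D i = 0" using D0[of i] by simp
      obtain D' where D': "0 < D'" "D' < \<rho> K" "pexp_gauge t D' \<le> (1 / 2) ^ (i + 2)"
        using pexp_gauge_small[OF \<open>0 < t\<close>, of "(1 / 2) ^ (i + 2)" "\<rho> K"] \<rho>0 by auto
      obtain G where "G \<in> sets P" "pre (E i) \<subseteq> G" "emeasure P G \<le> ennreal (pexp_gauge t D')"
        using hull[OF D'(1,2), of "E i"] W D'(1) \<open>D i = 0\<close> by (metis less_imp_le order_trans)
      then show ?thesis
        using ennreal_leI[OF D'(3)] by (auto intro!: bexI[of _ G] add_increasing elim: order_trans)
    qed
    then obtain G where G: "\<And>i. G i \<in> sets P" "\<And>i. pre (E i) \<subseteq> G i"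
      "\<And>i. emeasure P (G i) \<le> ennreal (pexp_gauge t (D i)) + ennreal ((1 / 2) ^ (i + 2))"
      by metis
    have "space P \<subseteq> (\<Union>i. G i)"
    proof
      fix \<omega> assume \<omega>: "\<omega> \<in> space P"
      have "\<mu> \<omega> \<in> (\<Union>i. E i)" unfolding UN \<mu>_def by (rule blend_measure_in_borel_probs)
      then show "\<omega> \<in> (\<Union>i. G i)" using G(2) \<omega> by (auto simp: pre_def)
    qed
    then have "emeasure P (space P) \<le> emeasure P (\<Union>i. G i)" using G(1) by (intro emeasure_mono) auto
    also have "\<dots> \<le> (\<Sum>i. emeasure P (G i))" using G(1) by (intro emeasure_subadditive_countably) auto
    also have "\<dots> \<le> (\<Sum>i. ennreal (pexp_gauge t (D i)) + ennreal ((1 / 2) ^ (i + 2)))"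
      using G(3) by (intro suminf_le) auto
    also have "\<dots> = (\<Sum>i. ennreal (pexp_gauge t (D i))) + (\<Sum>i. ennreal ((1 / 2) ^ (i + 2)))"
      by (intro suminf_add[symmetric]) auto
    also have "(\<Sum>i. ennreal ((1 / 2) ^ (i + 2))) = ennreal (1 / 2)"
    proof (rule suminf_ennreal_eq)
      show "(\<lambda>i. (1 / 2 :: real) ^ (i + 2)) sums (1 / 2)"
        using sums_mult[OF geometric_sums[of "1 / 2 :: real"], of "1 / 4"] by (simp add: power_add mult.commute)
    qed simp
    also have "emeasure P (space P) = ennreal (1 / 2) + ennreal (1 / 2)"
      unfolding P.emeasure_space_1 by (subst ennreal_plus[symmetric]) simp_all
    finally have "ennreal (1 / 2) + ennreal (1 / 2) \<le> ennreal (1 / 2) + (\<Sum>i. ennreal (pexp_gauge t (D i)))"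
      by (simp only: add.commute)
    then have "ennreal (1 / 2) \<le> (\<Sum>i. ennreal (pexp_gauge t (D i)))"
      unfolding ennreal_add_left_cancel_le by simp
    then show "ennreal (1 / 2) \<le> (\<Sum>i. ennreal (pexp_gauge t (enn2real (diam_on (wasserstein_dist p) (E i)))))"
      by (simp add: D_def)
  qed
  also have "\<dots> \<le> gauge_measure (pexp_gauge t) (borel_probs :: 'a measure set) (wasserstein_dist p)"
    unfolding gauge_measure_eq_SUP using \<rho>0[of K] by (intro SUP_upper) auto
  finally show ?thesis by (rule less_le_trans[rotated]) (subst ennreal_less_zero_iff, simp)
qed

text \<open>The intermediate value \<open>u'\<close> leaves room between the gauge exponent
  \<open>t\<close> and the exponent \<open>t'\<close> of the separated sets; this gap absorbs the
  loss in passing from one radius to the next.\<close>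

lemma hausdorff_dim_le_crit_pexp_wasserstein:
  fixes p :: real
  assumes compact: "compact (UNIV :: 'a::metric_space set)" and "1 \<le> p"
  shows "hausdorff_dim (UNIV :: 'a set) dist \<le> crit_pexp (borel_probs :: 'a measure set) (wasserstein_dist p)"
proof (rule dense_le)
  fix u assume "u < hausdorff_dim (UNIV :: 'a set) dist"
  then obtain u' where u': "u < u'" "u' < hausdorff_dim (UNIV :: 'a set) dist" using dense by blast
  define t where "t = enn2real u"
  define t' where "t' = enn2real u'"
  have eq: "u = ennreal t" "u' = ennreal t'"
    using u' by (auto simp: t_def t'_def intro!: ennreal_enn2real[symmetric] dest: order.strict_trans less_le_trans[OF _ top_greatest])
  show "u \<le> crit_pexp (borel_probs :: 'a measure set) (wasserstein_dist p)"
  proof (cases "0 < t")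
    case True
    have "t < t'" using u'(1) True by (simp add: eq ennreal_less_iff)
    have "0 < gauge_measure (pexp_gauge t) (borel_probs :: 'a measure set) (wasserstein_dist p)"
    proof (rule gauge_measure_pexp_wasserstein_pos[OF assms True \<open>t < t'\<close>])
      show "\<forall>\<^sub>F r in at_right 0. \<exists>S :: 'a set. finite S \<and> pairwise (\<lambda>x y. r \<le> dist x y) S
          \<and> r powr -t' + 1 \<le> real (card S)"
        by (rule separated_set_of_hausdorff_dim) (use True \<open>t < t'\<close> u'(2) eq(2) in auto)
    qed
    then show ?thesis
      unfolding crit_pexp_def critical_parameter_def eq(1) using True by (intro SUP_upper) auto
  next
    case False
    then show ?thesis by (simp add: eq(1) ennreal_neg)
  qed
qed

theorem corollary1p5:
  fixes p :: real and d :: ennreal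
  assumes "compact (UNIV :: 'a::metric_space set)"
    and "1 \<le> p"
    and "hausdorff_dim (UNIV :: 'a set) dist = d"
    and "upper_minkowski_dim (UNIV :: 'a set) = d"
  shows "crit_pexp (borel_probs :: 'a measure set) (wasserstein_dist p) = d"
  using crit_pexp_wasserstein_le[OF assms(1,2)] hausdorff_dim_le_crit_pexp_wasserstein[OF assms(1,2)] assms(3,4)
  by (simp add: order_antisym)

end
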